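(* Let $n\ge 1$. The identity matrix $I$ is an almost globally asymptotically stable equilibrium for the differential equation $$\dot\Theta=(\Theta^{\mathsf T}-\Theta)\Theta,\qquad \Theta\in SO(n).$$
   Context: $SO(n)=\{\Theta\in\mathbb{R}^{n\times n}\mid \Theta^{-1}=\Theta^{\mathsf T},\ \det\Theta=1\}$, a smooth submanifold of $\mathbb{R}^{n\times n}$ with the subspace topology. An equilibrium is almost globally asymptotically stable if it is (locally, in the sense of Lyapunov) asymptotically stable and the set of initial conditions in the state space whose solutions do not converge to it has measure zero. A subset $A$ of a smooth $m$-dimensional manifold $\mathcal{M}$ has measure zero if there is a collection of smooth charts $(U_l,\phi_l)$ whose domains cover $A$ and such that each $\phi_l(A\cap U_l)$ has Lebesgue measure zero in $\mathbb{R}^m$. *)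

theory Defs
  imports "HOL-Analysis.Analysis"
begin

definition special_orthogonal :: "(real ^ 'n ^ 'n) set" where
  "special_orthogonal = {Q. orthogonal_matrix Q \<and> det Q = 1}"


section \<open>Smooth charts and sets of measure zero\<close>

text \<open>
  Charts take values in R^m for a natural number m that is a term (and may be 0), so R^m is the set
  of extensional functions on \<open>{..<m}\<close>. This is the carrier of the product
  measure \<open>Pi\<^sub>M {..<m} (\<lambda>_. lborel)\<close>; for m = 0 it is a single point of measure 1.
\<close>

definition coord_space :: "nat \<Rightarrow> (nat \<Rightarrow> real) set" where
  "coord_space m = {..<m} \<rightarrow>\<^sub>E UNIV"

text \<open>
  All partial derivatives of order at most k exist and are continuous on S. Here
  \<open>shift i t x\<close> is the point x moved by t in the i-th coordinate direction and I is the set of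
  directions, so that the definition serves both for R^m and for an ambient Euclidean space.
  It is meant for open S, since the difference quotients evaluate f in a neighbourhood of each point.
\<close>

primrec C_k_on ::
  "('i \<Rightarrow> real \<Rightarrow> 'p \<Rightarrow> 'p) \<Rightarrow> 'i set \<Rightarrow> nat \<Rightarrow> 'p set \<Rightarrow>
   ('p::topological_space \<Rightarrow> 'b::real_normed_vector) \<Rightarrow> bool" where
  "C_k_on shift I 0 S f \<longleftrightarrow> continuous_on S f"
| "C_k_on shift I (Suc k) S f \<longleftrightarrow> continuous_on S f \<and>
     (\<forall>i\<in>I. \<exists>g. (\<forall>x\<in>S. ((\<lambda>t. f (shift i t x)) has_vector_derivative g x) (at 0)) \<and>
                C_k_on shift I k S g)"

definition smooth_on_coord_space ::
  "nat \<Rightarrow> (nat \<Rightarrow> real) set \<Rightarrow> ((nat \<Rightarrow> real) \<Rightarrow> 'b::real_normed_vector) \<Rightarrow> bool" where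
  "smooth_on_coord_space m W f \<longleftrightarrow>
     (\<forall>k. C_k_on (\<lambda>i t x. x(i := x i + t)) {..<m} k W f)"

definition smooth_on_open ::
  "'a::euclidean_space set \<Rightarrow> ('a \<Rightarrow> 'b::real_normed_vector) \<Rightarrow> bool" where
  "smooth_on_open V f \<longleftrightarrow> (\<forall>k. C_k_on (\<lambda>b t x. x + t *\<^sub>R b) Basis k V f)"

text \<open>Smoothness on an arbitrary subset of a Euclidean space: local smooth extensions exist.\<close>

definition smooth_on_subset ::
  "'a::euclidean_space set \<Rightarrow> ('a \<Rightarrow> 'b::real_normed_vector) \<Rightarrow> bool" where
  "smooth_on_subset U f \<longleftrightarrow>
     (\<forall>p\<in>U. \<exists>V F. open V \<and> p \<in> V \<and> smooth_on_open V F \<and> (\<forall>x\<in>U \<inter> V. F x = f x))"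

text \<open>
  Charts of an m-dimensional smooth submanifold M of a Euclidean space: diffeomorphisms from a
  relatively open subset of M onto an open subset of R^m.
\<close>

definition smooth_chart ::
  "nat \<Rightarrow> 'a::euclidean_space set \<Rightarrow> 'a set \<Rightarrow> ('a \<Rightarrow> nat \<Rightarrow> real) \<Rightarrow> bool" where
  "smooth_chart m M U \<phi> \<longleftrightarrow>
     openin (top_of_set M) U \<and>
     openin (top_of_set (coord_space m)) (\<phi> ` U) \<and>
     (\<forall>i<m. smooth_on_subset U (\<lambda>p. \<phi> p i)) \<and>
     (\<exists>\<psi>. homeomorphism U (\<phi> ` U) \<phi> \<psi> \<and> smooth_on_coord_space m (\<phi> ` U) \<psi>)"

definition manifold_measure_zero ::
  "nat \<Rightarrow> 'a::euclidean_space set \<Rightarrow> 'a set \<Rightarrow> bool" where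
  "manifold_measure_zero m M A \<longleftrightarrow> A \<subseteq> M \<and>
     (\<exists>\<C>. (\<forall>(U, \<phi>)\<in>\<C>. smooth_chart m M U \<phi>) \<and>
          A \<subseteq> (\<Union>(U, \<phi>)\<in>\<C>. U) \<and>
          (\<forall>(U, \<phi>)\<in>\<C>. \<phi> ` (A \<inter> U) \<in> null_sets (completion (Pi\<^sub>M {..<m} (\<lambda>_. lborel)))))"


section \<open>Stability of equilibria\<close>

definition ode_solution ::
  "('a::euclidean_space \<Rightarrow> 'a) \<Rightarrow> 'a set \<Rightarrow> 'a \<Rightarrow> (real \<Rightarrow> 'a) \<Rightarrow> bool" where
  "ode_solution f M x0 \<theta> \<longleftrightarrow> \<theta> 0 = x0 \<and>
     (\<forall>t\<ge>0. \<theta> t \<in> M \<and> (\<theta> has_vector_derivative f (\<theta> t)) (at t within {0..}))"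

definition equilibrium :: "('a::euclidean_space \<Rightarrow> 'a) \<Rightarrow> 'a set \<Rightarrow> 'a \<Rightarrow> bool" where
  "equilibrium f M xe \<longleftrightarrow> xe \<in> M \<and> f xe = 0"

text \<open>
  Existence of solutions for all forward time is part of the following two notions, so that they
  cannot hold vacuously.
\<close>

definition lyapunov_stable :: "('a::euclidean_space \<Rightarrow> 'a) \<Rightarrow> 'a set \<Rightarrow> 'a \<Rightarrow> bool" where
  "lyapunov_stable f M xe \<longleftrightarrow>
     (\<forall>\<epsilon>>0. \<exists>\<delta>>0. \<forall>x0\<in>M. dist x0 xe < \<delta> \<longrightarrow>
        (\<exists>\<theta>. ode_solution f M x0 \<theta>) \<and>
        (\<forall>\<theta>. ode_solution f M x0 \<theta> \<longrightarrow> (\<forall>t\<ge>0. dist (\<theta> t) xe < \<epsilon>)))"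

definition region_of_attraction ::
  "('a::euclidean_space \<Rightarrow> 'a) \<Rightarrow> 'a set \<Rightarrow> 'a \<Rightarrow> 'a set" where
  "region_of_attraction f M xe =
     {x0\<in>M. (\<exists>\<theta>. ode_solution f M x0 \<theta>) \<and>
            (\<forall>\<theta>. ode_solution f M x0 \<theta> \<longrightarrow> (\<theta> \<longlongrightarrow> xe) at_top)}"

definition asymptotically_stable :: "('a::euclidean_space \<Rightarrow> 'a) \<Rightarrow> 'a set \<Rightarrow> 'a \<Rightarrow> bool" where
  "asymptotically_stable f M xe \<longleftrightarrow>
     lyapunov_stable f M xe \<and>
     (\<exists>\<delta>>0. \<forall>x0\<in>M. dist x0 xe < \<delta> \<longrightarrow> x0 \<in> region_of_attraction f M xe)"

definition almost_globally_asymptotically_stable ::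
  "nat \<Rightarrow> ('a::euclidean_space \<Rightarrow> 'a) \<Rightarrow> 'a set \<Rightarrow> 'a \<Rightarrow> bool" where
  "almost_globally_asymptotically_stable m f M xe \<longleftrightarrow>
     equilibrium f M xe \<and> asymptotically_stable f M xe \<and>
     manifold_measure_zero m M (M - region_of_attraction f M xe)"

end

(* On SO(n) the equation reads T' = I - T^2 and has the explicit solution
   (Q + r I)(I + r Q)^{-1} with r = tanh t, through every Q. It tends to I whenever I + Q is invertible,
   and the distance to I never increases because T.I is nondecreasing (Cauchy-Schwarz). Hence only the
   rotations with eigenvalue -1 can fail to converge. Around any P in SO(n) the Cayley
   transform Q = P (I - X)(I + X)^{-1}, X skew, is a chart onto all of R^m, in which this exceptional
   set lies in the zero set of det((I + X) + P (I - X)). That polynomial is not identically zero, since the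
   rotations without eigenvalue -1 are dense, so by Fubini its zero set is null. *)
theory Submission imports Defs begin

text \<open>Attraction is demanded of every solution, so the explicit formula has to be shown to be
  the only one; the deviation of any solution from it obeys a linear equation, and an energy
  estimate makes it vanish. The Cayley chart at I says nothing about the exceptional set, because
  its domain is exactly the complement of that set; hence a chart around each P. At X = 0 the
  polynomial of that chart has the value det (I + P), which is 0 when P is exceptional, so a point
  of nonvanishing must be found elsewhere. This is where determinant 1 enters: an orthogonal matrix
  of determinant -1 always has the eigenvalue -1, whereas for a rotation the eigenspace of -1 is
  never a line, and turning slightly in a plane inside it makes it smaller.\<close>

section \<open>Matrix algebra and orthogonal matrices\<close>

lemma bounded_bilinear_matrix_mult:
  "bounded_bilinear ((**) :: real^'m^'n \<Rightarrow> real^'p^'m \<Rightarrow> real^'p^'n)"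
  unfolding bilinear_conv_bounded_bilinear[symmetric]
  by (auto simp: bilinear_def matrix_matrix_mult_def vec_eq_iff sum.distrib algebra_simps
      sum_distrib_left intro!: linearI)

interpretation mm: bounded_bilinear "(**) :: real^'m^'n \<Rightarrow> real^'p^'m \<Rightarrow> real^'p^'n"
  by (rule bounded_bilinear_matrix_mult)

lemmas matrix_mult_simps = mm.add_left mm.add_right mm.diff_left mm.diff_right
  mm.minus_left mm.minus_right mm.scaleR_left mm.scaleR_right

lemma transpose_add: "transpose (A + B) = transpose A + transpose (B :: real^'m^'n)"
  and transpose_diff: "transpose (A - B) = transpose A - transpose (B :: real^'m^'n)"
  by (simp_all add: transpose_def vec_eq_iff)

text \<open>Writing the inverse by Cramer's rule makes its entries visibly rational in those of
  \<open>A\<close>, so smoothness of the flow and of the charts reduces to sums, products and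
  reciprocals of real functions.\<close>

definition cramer_inv :: "real^'n^'n \<Rightarrow> real^'n^'n" where
  "cramer_inv A = (\<chi> i j. det (\<chi> p q. if q = i then mat 1 $ p $ j else A $ p $ q) / det A)"

lemma cramer_inv_right: "A ** cramer_inv A = mat 1"
  and cramer_inv_left: "cramer_inv A ** A = mat 1" if A: "det A \<noteq> 0" for A :: "real^'n^'n"
proof -
  obtain B where B: "A ** B = mat 1" "B ** A = mat 1"
    using A by (auto simp: invertible_def simp flip: invertible_det_nz)
  have "column j B = column j (cramer_inv A)" for j
  proof -
    have "A *v column j B = column j (mat 1)"
      using B(1) by (metis matrix_vector_mult_basis matrix_vector_mul_assoc)
    then have "column j B = (\<chi> k. det (\<chi> p q. if q = k then column j (mat 1) $ p else A $ p $ q) / det A)"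
      by (simp add: cramer[OF A])
    then show ?thesis
      by (simp add: vec_eq_iff column_def cramer_inv_def cong: if_cong)
  qed
  then have "cramer_inv A = B"
    by (simp add: vec_eq_iff column_def)
  then show "A ** cramer_inv A = mat 1" "cramer_inv A ** A = mat 1"
    using B by auto
qed

lemma matrix_mult_right_cancel:
  fixes A B N :: "real^'n^'n"
  assumes "det N \<noteq> 0" "A ** N = B ** N"
  shows "A = B"
proof -
  have "A ** N ** cramer_inv N = B ** N ** cramer_inv N"
    using assms(2) by simp
  then show ?thesis
    by (simp add: cramer_inv_right[OF assms(1)] flip: matrix_mul_assoc)
qed

lemma det_nonzero_iff_kernel:
  fixes A :: "real^'n^'n"
  shows "det A \<noteq> 0 \<longleftrightarrow> (\<forall>x. A *v x = 0 \<longrightarrow> x = 0)"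
  by (metis invertible_det_nz invertible_left_inverse matrix_left_invertible_ker)

lemma orthogonal_matrix_inner:
  fixes Q :: "real^'n^'n"
  assumes "orthogonal_matrix Q"
  shows "(Q *v x) \<bullet> (Q *v y) = x \<bullet> y"
proof -
  have "(Q *v x) \<bullet> (Q *v y) = (x v* transpose Q) \<bullet> (Q *v y)"
    by simp
  also have "\<dots> = x \<bullet> ((transpose Q ** Q) *v y)"
    by (simp only: dot_lmul_matrix matrix_vector_mul_assoc)
  also have "\<dots> = x \<bullet> y"
    using assms by (simp add: orthogonal_matrix)
  finally show ?thesis .
qed

lemma special_orthogonal_mult:
  "P \<in> special_orthogonal \<Longrightarrow> Q \<in> special_orthogonal \<Longrightarrow> P ** Q \<in> special_orthogonal"
  by (simp add: special_orthogonal_def orthogonal_matrix_mul det_mul)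

text \<open>The norm of \<open>real^'n^'n\<close> is the Frobenius norm, whose square is the trace
  of \<open>transpose A ** A\<close>; there \<open>Q\<close> cancels.\<close>

lemma norm_matrix_mult_orthogonal:
  fixes Q A :: "real^'n^'n"
  assumes "orthogonal_matrix Q"
  shows "norm (Q ** A) = norm A"
proof -
  have tr: "B \<bullet> B = trace (transpose B ** B)" for B :: "real^'n^'n"
    by (simp add: inner_vec_def trace_def matrix_matrix_mult_def transpose_def)
       (rule sum.swap)
  have "transpose (Q ** A) ** (Q ** A) = transpose A ** (transpose Q ** Q) ** A"
    by (simp add: matrix_transpose_mul matrix_mul_assoc)
  also have "\<dots> = transpose A ** A"
    using assms by (simp add: orthogonal_matrix)
  finally have "transpose (Q ** A) ** (Q ** A) = transpose A ** A" .
  then show ?thesis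
    by (simp add: norm_eq_sqrt_inner tr)
qed

text \<open>Factoring \<open>Q\<close> out of \<open>mat 1 + Q\<close> leaves the transpose of
  \<open>mat 1 + Q\<close>, which has the same determinant. Contrapositively, determinant -1 forces
  the eigenvalue -1.\<close>

lemma det_orthogonal_eq_1:
  fixes Q :: "real^'n^'n"
  assumes "orthogonal_matrix Q" "det (mat 1 + Q) \<noteq> 0"
  shows "det Q = 1"
proof -
  have "mat 1 + Q = Q ** transpose (mat 1 + Q)"
    using assms(1) by (simp add: transpose_add matrix_mult_simps orthogonal_matrix_def)
  then have "det (mat 1 + Q) = det Q * det (mat 1 + Q)"
    by (metis det_mul det_transpose)
  then show ?thesis using assms(2) by simp
qed

section \<open>Reflections and the density of rotations without eigenvalue -1\<close>

text \<open>The Householder reflection in the hyperplane orthogonal to \<open>v\<close>. For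
  \<open>v = 0\<close> the coefficient is \<open>2 / 0 = 0\<close> and the matrix is the identity,
  so it is an involution for every \<open>v\<close>.\<close>

definition reflection :: "real^'n \<Rightarrow> real^'n^'n" where
  "reflection v = mat 1 - (2 / (v \<bullet> v)) *\<^sub>R (\<chi> i j. v $ i * v $ j)"

lemma reflection_mult: "reflection v *v x = x - (2 * (v \<bullet> x) / (v \<bullet> v)) *\<^sub>R v"
proof -
  have "(\<chi> i j. v $ i * v $ j) *v x = (v \<bullet> x) *\<^sub>R v"
    by (simp add: vec_eq_iff matrix_vector_mult_def inner_vec_def sum_distrib_left mult_ac)
  then show ?thesis
    by (simp add: reflection_def matrix_vector_mult_diff_rdistrib flip: scaleR_matrix_vector_assoc)
qed

lemma reflection_involution: "reflection v ** reflection v = mat 1"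
proof (cases "v = 0")
  case False
  have "reflection v *v (reflection v *v x) = x" for x
  proof -
    have "v \<bullet> (reflection v *v x) = - (v \<bullet> x)"
      using False by (simp add: reflection_mult inner_diff_right)
    then show ?thesis
      using reflection_mult[of v "reflection v *v x"] by (simp add: reflection_mult[of v x])
  qed
  then show ?thesis
    by (simp add: matrix_eq flip: matrix_vector_mul_assoc)
qed (simp add: reflection_def)

lemma transpose_reflection: "transpose (reflection v) = reflection v"
  by (simp add: reflection_def transpose_def vec_eq_iff mat_def mult.commute)

lemma orthogonal_matrix_reflection: "orthogonal_matrix (reflection v)"
  by (simp add: orthogonal_matrix transpose_reflection reflection_involution)

lemma det_reflection_axis: "det (reflection (axis k 1 :: real^'n)) = -1"
proof -
  have "det (reflection (axis k 1 :: real^'n)) = (\<Prod>i\<in>UNIV. reflection (axis k 1 :: real^'n) $ i $ i)"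
    by (rule det_diagonal) (auto simp: reflection_def mat_def axis_def)
  also have "\<dots> = (\<Prod>i\<in>UNIV. if i = k then -1 else 1)"
    unfolding reflection_def inner_axis_axis
    by (rule prod.cong) (auto simp: mat_def axis_def)
  finally show ?thesis by simp
qed

text \<open>An orthogonal \<open>A\<close> carrying a coordinate axis to the direction of
  \<open>v\<close> conjugates the diagonal reflection into this one.\<close>

lemma det_reflection:
  fixes v :: "real^'n"
  assumes "v \<noteq> 0"
  shows "det (reflection v) = -1"
proof -
  obtain k :: 'n where True by simp
  obtain A where A: "orthogonal_matrix A" "A *v axis k 1 = v /\<^sub>R norm v"
    using orthogonal_matrix_exists_basis[of "v /\<^sub>R norm v" k] assms by auto
  define e :: "real^'n" where "e = axis k 1"
  have v: "v = norm v *\<^sub>R (A *v e)"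
    using A(2) assms by (simp add: e_def)
  have ip: "v \<bullet> (A *v x) = norm v * (e \<bullet> x)" for x
    by (subst v) (simp add: orthogonal_matrix_inner[OF A(1)])
  have "(reflection v ** A) *v x = (A ** reflection e) *v x" for x
  proof -
    have "(reflection v ** A) *v x = A *v x - (2 * (norm v * (e \<bullet> x)) / (v \<bullet> v)) *\<^sub>R v"
      by (simp add: reflection_mult ip flip: matrix_vector_mul_assoc)
    also have "(2 * (norm v * (e \<bullet> x)) / (v \<bullet> v)) *\<^sub>R v = (2 * (e \<bullet> x)) *\<^sub>R (A *v e)"
      using assms by (subst (3) v) (simp add: dot_square_norm power2_eq_square)
    also have "A *v x - \<dots> = (A ** reflection e) *v x"
      by (simp add: reflection_mult e_def inner_axis_axis algebra_simps flip: matrix_vector_mul_assoc)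
    finally show ?thesis .
  qed
  then have "reflection v ** A = A ** reflection e"
    by (simp add: matrix_eq)
  then have "det (reflection v) * det A = det A * det (reflection e)"
    by (metis det_mul)
  moreover have "det A \<noteq> 0"
    using det_orthogonal_matrix[OF A(1)] by auto
  ultimately have "det (reflection v) = det (reflection e)"
    by (metis mult.commute mult_cancel_left)
  then show ?thesis
    by (simp add: e_def det_reflection_axis)
qed

text \<open>For a rotation the eigenvalue -1 has even multiplicity. This special case supplies the
  second eigenvector that spans, together with \<open>v\<close>, the plane of the later
  perturbation.\<close>

lemma eigenspace_not_line:
  fixes Q :: "real^'n^'n"
  assumes Q: "Q \<in> special_orthogonal" and v: "v \<noteq> 0" "Q *v v = - v"
  obtains w where "Q *v w = - w" "w \<notin> span {v}"
proof (rule ccontr)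
  note contra = that
  assume *: "\<not> thesis"
  then have ker: "w \<in> span {v}" if w: "Q *v w = - w" for w
    using contra[OF w] * by blast
  have o: "orthogonal_matrix Q"
    using Q by (simp add: special_orthogonal_def)
  \<comment> \<open>If the eigenspace were a line, reflecting it would remove the eigenvalue \<open>-1\<close>, forcing determinant 1.\<close>
  have "det (mat 1 + Q ** reflection v) \<noteq> 0"
    unfolding det_nonzero_iff_kernel
  proof (intro allI impI)
    fix x assume "(mat 1 + Q ** reflection v) *v x = 0"
    then have x: "Q *v (reflection v *v x) = - x"
      by (simp add: matrix_vector_mult_add_rdistrib matrix_vector_mul_assoc eq_neg_iff_add_eq_0
          add.commute)
    \<comment> \<open>\<open>Q\<close> preserves inner products, negates \<open>v\<close> and maps
      the reflected vector to \<open>- x\<close>. The reflection itself reverses the component along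
      \<open>v\<close>, so that component is 0.\<close>
    have "v \<bullet> (reflection v *v x) = v \<bullet> x"
      using orthogonal_matrix_inner[OF o, of v "reflection v *v x"] v x by simp
    then have vx: "v \<bullet> x = 0"
      using v by (simp add: reflection_mult inner_simps)
    then have "Q *v x = - x"
      using x by (simp add: reflection_mult)
    then obtain c where "x = c *\<^sub>R v"
      using ker by (auto simp: span_singleton)
    then show "x = 0"
      using vx v by simp
  qed
  then have "det (Q ** reflection v) = 1"
    by (rule det_orthogonal_eq_1[rotated]) (simp add: o orthogonal_matrix_mul orthogonal_matrix_reflection)
  then show False
    using Q v by (simp add: special_orthogonal_def det_mul det_reflection)
qed

text \<open>The two reflections compose to a rotation in the plane of \<open>u\<close> and
  \<open>v\<close>, where \<open>Q\<close> is minus the identity. If \<open>R *v x = - x\<close>,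
  the displacement of \<open>x\<close> under this rotation lies in the plane and, \<open>Q\<close>
  being an isometry, is orthogonal to it. So the rotation fixes \<open>x\<close>, which is therefore
  orthogonal to \<open>v\<close>, and \<open>v\<close> itself drops out of the eigenspace.\<close>

lemma eigenspace_decrease:
  fixes Q :: "real^'n^'n"
  assumes o: "orthogonal_matrix Q" and v: "v \<noteq> 0" "Q *v v = - v"
    and u: "Q *v u = - u" "u \<notin> span {v}"
  defines "R \<equiv> Q ** (reflection v ** reflection u)"
  shows "{x. R *v x = - x} \<subset> {x. Q *v x = - x}"
proof -
  have u0: "u \<noteq> 0" using u(2) by (auto simp: span_zero)
  have key: "v \<bullet> x = 0 \<and> Q *v x = - x" if x: "R *v x = - x" for x
  proof -
    define y where "y = reflection v *v (reflection u *v x)"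
    have Qy: "Q *v y = - x"
      using x by (simp add: R_def y_def flip: matrix_vector_mul_assoc)
    have ip: "z \<bullet> y = z \<bullet> x" if "Q *v z = - z" for z
      using orthogonal_matrix_inner[OF o, of z y] that Qy by simp
    have "y - x \<in> span {u, v}"
      unfolding y_def reflection_mult by (simp add: span_diff span_mul span_base span_neg algebra_simps)
    then obtain a b where "y - x = a *\<^sub>R u + b *\<^sub>R v"
      by (auto simp: span_insert span_singleton algebra_simps)
    then have "(y - x) \<bullet> (y - x) = a * (u \<bullet> (y - x)) + b * (v \<bullet> (y - x))"
      by (metis inner_add_left inner_scaleR_left)
    also have "\<dots> = 0"
      using ip[OF u(1)] ip[OF v(2)] by (simp add: inner_diff_right)
    finally have "(y - x) \<bullet> (y - x) = 0" .
    then have yx: "y = x" by simp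
    have "reflection v *v x = reflection u *v x"
      using yx unfolding y_def by (metis matrix_vector_mul_assoc matrix_vector_mul_lid reflection_involution)
    then have eq: "(2 * (u \<bullet> x) / (u \<bullet> u)) *\<^sub>R u = (2 * (v \<bullet> x) / (v \<bullet> v)) *\<^sub>R v"
      by (simp add: reflection_mult)
    have "u \<bullet> x = 0"
    proof (rule ccontr)
      assume ne: "u \<bullet> x \<noteq> 0"
      define c where "c = 2 * (u \<bullet> x) / (u \<bullet> u)"
      have "c \<noteq> 0" using ne u0 by (simp add: c_def)
      then have "u = (1 / c) *\<^sub>R (c *\<^sub>R u)" by simp
      then have "u = (1 / c * (2 * (v \<bullet> x) / (v \<bullet> v))) *\<^sub>R v"
        by (simp only: eq[folded c_def] scaleR_scaleR)
      then show False using u(2) by (metis span_base span_mul singletonI)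
    qed
    then have "v \<bullet> x = 0" using eq v(1) by auto
    then show ?thesis using Qy yx by simp
  qed
  have "R *v v \<noteq> - v"
    using key[of v] v(1) by auto
  with key v(2) show ?thesis by blast
qed

lemma special_orthogonal_open_meets_det_nonzero:
  fixes Q0 :: "real^'n^'n"
  assumes N: "open N" and Q0: "Q0 \<in> N" "Q0 \<in> special_orthogonal"
  obtains Q where "Q \<in> N" "Q \<in> special_orthogonal" "det (mat 1 + Q) \<noteq> 0"
proof -
  \<comment> \<open>At a point of the open set minimising the dimension of the \<open>-1\<close>-eigenspace, this space is trivial: otherwise
    a small rotation in a plane spanned by two eigenvectors makes it smaller.\<close>
  define K where "K Q = {x. Q *v x = - x}" for Q :: "real^'n^'n"
  have sub: "subspace (K Q)" for Q
    by (auto simp: K_def subspace_def algebra_simps)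
  obtain Q where Q: "Q \<in> N" "Q \<in> special_orthogonal"
    and min: "\<And>R. R \<in> N \<Longrightarrow> R \<in> special_orthogonal \<Longrightarrow> dim (K Q) \<le> dim (K R)"
    using Q0 arg_min_nat_lemma[of "\<lambda>Q. Q \<in> N \<and> Q \<in> special_orthogonal" Q0 "\<lambda>Q. dim (K Q)"] by blast
  have "det (mat 1 + Q) \<noteq> 0"
  proof (rule ccontr)
    assume "\<not> det (mat 1 + Q) \<noteq> 0"
    then obtain v where v: "v \<noteq> 0" "Q *v v = - v"
      using det_nonzero_iff_kernel[of "mat 1 + Q"]
      by (auto simp: matrix_vector_mult_add_rdistrib eq_neg_iff_add_eq_0 add.commute)
    obtain w where w: "Q *v w = - w" "w \<notin> span {v}"
      using eigenspace_not_line[OF Q(2) v] .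
    \<comment> \<open>At \<open>s = 0\<close> the two reflections in \<open>R s\<close> cancel; for
      \<open>s \<noteq> 0\<close> the vectors \<open>v\<close> and \<open>u s\<close> are
      independent, as \<open>eigenspace_decrease\<close> requires.\<close>
    define u where "u s = v + s *\<^sub>R w" for s :: real
    define R where "R s = Q ** (reflection v ** reflection (u s))" for s
    have u: "u s \<notin> span {v}" if "s \<noteq> 0" for s
    proof
      assume "u s \<in> span {v}"
      then have "(1 / s) *\<^sub>R (u s - v) \<in> span {v}"
        by (intro span_mul span_diff) (auto intro: span_base)
      then show False
        using w(2) that by (simp add: u_def)
    qed
    have "isCont (\<lambda>s. reflection (u s)) 0"
      unfolding isCont_def reflection_def u_def using v(1)
      by (intro tendsto_intros) auto
    then have "isCont R 0"
      unfolding R_def by (intro mm.isCont continuous_const)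
    moreover have "R 0 = Q"
      by (simp add: R_def u_def reflection_involution)
    ultimately have "(R \<longlongrightarrow> Q) (at 0)"
      by (simp add: isCont_def)
    then have "\<forall>\<^sub>F s in at 0. R s \<in> N"
      using N Q(1) by (rule topological_tendstoD)
    moreover have "\<forall>\<^sub>F s::real in at 0. s \<noteq> 0"
      by (simp add: eventually_at_filter)
    ultimately obtain s where s: "R s \<in> N" "s \<noteq> 0"
      using eventually_happens[OF eventually_conj] by force
    have u0: "u s \<noteq> 0" using u[OF s(2)] by (metis span_zero)
    have "R s \<in> special_orthogonal"
      unfolding R_def using Q(2)
      by (simp add: special_orthogonal_def orthogonal_matrix_mul orthogonal_matrix_reflection det_mul
          det_reflection v(1) u0)
    then have "dim (K Q) \<le> dim (K (R s))"
      using min s(1) by blast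
    moreover have "K (R s) \<subset> K Q"
      unfolding K_def R_def using Q(2) v w(1) u[OF s(2)]
      by (intro eigenspace_decrease) (auto simp: u_def special_orthogonal_def algebra_simps)
    then have "dim (K (R s)) < dim (K Q)"
      by (intro dim_psubset) (metis span_eq_iff sub)
    ultimately show False by simp
  qed
  with Q that show thesis by blast
qed

section \<open>Null zero sets of separately polynomial functions\<close>

lemma finite_zeros_real_polynomial_function:
  fixes p :: "real \<Rightarrow> real"
  assumes "real_polynomial_function p" "p c \<noteq> 0"
  shows "finite {t. p t = 0}"
proof -
  obtain a n where p: "p = (\<lambda>x. \<Sum>i\<le>n. a i * x ^ i)"
    using assms(1) real_polynomial_function_iff_sum by blast
  have "\<exists>k\<le>n. a k \<noteq> 0"
    using assms(2) unfolding p by (metis (no_types, lifting) atMost_iff mult_zero_left sum.neutral)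
  then show ?thesis
    unfolding p using polyfun_finite_roots[of a n] by blast
qed

text \<open>Fubini in one coordinate: freezing coordinate \<open>i\<close> at \<open>c i\<close>
  leaves a function of fewer variables, again with a point where it is nonzero. Wherever it is
  nonzero, the polynomial in coordinate \<open>i\<close> is nontrivial and has finitely many
  roots.\<close>

lemma AE_PiM_separately_polynomial_nonzero:
  fixes f :: "('i \<Rightarrow> real) \<Rightarrow> real"
  assumes "finite I" and "f \<in> borel_measurable (Pi\<^sub>M I (\<lambda>_. lborel))"
    and "\<And>x i. i \<in> I \<Longrightarrow> real_polynomial_function (\<lambda>t. f (x(i := t)))"
    and "c \<in> I \<rightarrow>\<^sub>E UNIV" "f c \<noteq> 0"
  shows "AE x in Pi\<^sub>M I (\<lambda>_. lborel). f x \<noteq> 0"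
  using assms
proof (induction I arbitrary: f c rule: finite_induct)
  \<comment> \<open>With no coordinates the space is a single point, which must be
    \<open>c\<close>.\<close>
  case empty
  then show ?case
    by (intro AE_I2) (auto simp: space_PiM PiE_def extensional_def)
next
  case (insert i J)
  interpret product_sigma_finite "\<lambda>_::'i. lborel :: real measure" ..
  note [measurable] = insert.prems(1)
  define g where "g y = f (y(i := c i))" for y
  have "AE y in Pi\<^sub>M J (\<lambda>_. lborel). g y \<noteq> 0"
  proof (rule insert.IH)
    show "g \<in> borel_measurable (Pi\<^sub>M J (\<lambda>_. lborel))"
      unfolding g_def
      by (rule measurable_compose[OF measurable_fun_upd[where J = J] insert.prems(1)]) auto
    show "real_polynomial_function (\<lambda>t. g (y(j := t)))" if "j \<in> J" for y j
    proof -
      have "j \<noteq> i" using that insert.hyps by auto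
      then have "(\<lambda>t. g (y(j := t))) = (\<lambda>t. f ((y(i := c i))(j := t)))"
        by (simp add: g_def fun_upd_twist)
      then show ?thesis
        using insert.prems(2)[of j "y(i := c i)"] that by (simp only: insert_iff simp_thms)
    qed
    \<comment> \<open>Points over \<open>J\<close> are \<open>undefined\<close> at \<open>i\<close>;
      \<open>g\<close> puts \<open>c i\<close> back, so its value here is
      \<open>f c\<close>.\<close>
    show "c(i := undefined) \<in> J \<rightarrow>\<^sub>E UNIV"
      using insert.prems(3) insert.hyps by (auto simp: PiE_def extensional_def)
    show "g (c(i := undefined)) \<noteq> 0"
      using insert.prems(4) by (simp add: g_def)
  qed
  then have ae: "AE y in Pi\<^sub>M J (\<lambda>_. lborel). (\<integral>\<^sup>+ t. indicator {0} (f (y(i := t))) \<partial>lborel) = 0"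
  proof (rule AE_mp, intro AE_I2 impI)
    fix y assume "g y \<noteq> 0"
    then have "finite {t. f (y(i := t)) = 0}"
      unfolding g_def
      by (intro finite_zeros_real_polynomial_function[of "\<lambda>t. f (y(i := t))" "c i"] insert.prems(2)) auto
    then have "{t. f (y(i := t)) = 0} \<in> null_sets lborel"
      by (rule finite_imp_null_set_lborel)
    then have "AE t in lborel. f (y(i := t)) \<noteq> 0"
      by (auto dest: AE_not_in)
    then have "(\<integral>\<^sup>+ t. indicator {0} (f (y(i := t))) \<partial>lborel) = (\<integral>\<^sup>+ t. 0 \<partial>(lborel :: real measure))"
      by (intro nn_integral_cong_AE) auto
    then show "(\<integral>\<^sup>+ t. indicator {0} (f (y(i := t))) \<partial>lborel) = 0"
      by simp
  qed
  have "(\<integral>\<^sup>+ x. indicator {0} (f x) \<partial>Pi\<^sub>M (insert i J) (\<lambda>_. lborel)) =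
      (\<integral>\<^sup>+ y. (\<integral>\<^sup>+ t. indicator {0} (f (y(i := t))) \<partial>lborel) \<partial>Pi\<^sub>M J (\<lambda>_. lborel))"
    using insert.hyps by (intro product_nn_integral_insert) auto
  also have "\<dots> = (\<integral>\<^sup>+ y. 0 \<partial>Pi\<^sub>M J (\<lambda>_. lborel :: real measure))"
    by (intro nn_integral_cong_AE ae)
  finally have "(\<integral>\<^sup>+ x. indicator {0} (f x) \<partial>Pi\<^sub>M (insert i J) (\<lambda>_. lborel)) = (0 :: ennreal)"
    by simp
  then have "AE x in Pi\<^sub>M (insert i J) (\<lambda>_. lborel). indicator {0} (f x) = (0 :: ennreal)"
    by (subst (asm) nn_integral_0_iff_AE) auto
  then show ?case
    by (auto simp: indicator_def)
qed

lemma real_polynomial_function_det: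
  fixes M :: "real \<Rightarrow> real^'n^'n"
  assumes "\<And>i j. real_polynomial_function (\<lambda>t. M t $ i $ j)"
  shows "real_polynomial_function (\<lambda>t. det (M t))"
  unfolding det_def
  by (rule real_polynomial_function_sum, simp,
      rule real_polynomial_function.intros(4)[OF real_polynomial_function.intros(2)],
      rule real_polynomial_function_prod[OF finite assms])

section \<open>Closure rules for k times continuously differentiable functions\<close>

text \<open>The product and reciprocal rules ask of a shift only that moving by 0 does nothing. One
  development thus serves coordinate space, the ambient matrix space and the real line.\<close>

locale coordinate_shift =
  fixes shift :: "'i \<Rightarrow> real \<Rightarrow> 'p \<Rightarrow> 'p :: topological_space" and I :: "'i set"
  assumes shift_0: "i \<in> I \<Longrightarrow> shift i 0 x = x"
begin

abbreviation Ck :: "nat \<Rightarrow> 'p set \<Rightarrow> ('p \<Rightarrow> 'b::real_normed_vector) \<Rightarrow> bool" where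
  "Ck \<equiv> C_k_on shift I"

lemma Ck_continuous: "Ck k S f \<Longrightarrow> continuous_on S f"
  by (cases k) auto

lemma Ck_Suc_D: "Ck (Suc k) S f \<Longrightarrow> Ck k S f"
proof (induction k arbitrary: f)
  case (Suc k)
  then show ?case
    by (subst C_k_on.simps(2), subst (asm) C_k_on.simps(2)) blast
qed simp

lemma Ck_SucI:
  assumes "continuous_on S f"
    and "\<And>i. i \<in> I \<Longrightarrow> \<exists>g. (\<forall>x\<in>S. ((\<lambda>t. f (shift i t x)) has_vector_derivative g x) (at 0)) \<and> Ck k S g"
  shows "Ck (Suc k) S f"
  using assms by simp

lemma Ck_SucE:
  assumes "Ck (Suc k) S f" "i \<in> I"
  obtains g where "\<And>x. x \<in> S \<Longrightarrow> ((\<lambda>t. f (shift i t x)) has_vector_derivative g x) (at 0)"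
    "Ck k S g"
  using assms(1)[unfolded C_k_on.simps] assms(2) that by blast

lemma Ck_const: "Ck k S (\<lambda>x. c)"
proof (induction k arbitrary: c)
  case (Suc k)
  show ?case
    by (rule Ck_SucI) (auto intro!: exI[of _ "\<lambda>x. 0"] Suc)
qed simp

text \<open>Meant for affine maps, whose directional derivatives do not depend on the point.\<close>

lemma Ck_constant_derivative:
  assumes "continuous_on S f"
    and "\<And>i x. i \<in> I \<Longrightarrow> x \<in> S \<Longrightarrow> ((\<lambda>t. f (shift i t x)) has_vector_derivative c i) (at 0)"
  shows "Ck k S f"
proof (cases k)
  case (Suc l)
  show ?thesis
    unfolding Suc using assms by (intro Ck_SucI) (auto intro!: exI[of _ "\<lambda>x. c _"] Ck_const)
qed (simp add: assms)

lemma Ck_add: "Ck k S f \<Longrightarrow> Ck k S g \<Longrightarrow> Ck k S (\<lambda>x. f x + g x)"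
proof (induction k arbitrary: f g)
  case (Suc k)
  show ?case
  proof (rule Ck_SucI)
    show "continuous_on S (\<lambda>x. f x + g x)"
      using Suc.prems by (auto intro: continuous_on_add)
    fix i assume i: "i \<in> I"
    obtain f' where f': "\<And>x. x \<in> S \<Longrightarrow> ((\<lambda>t. f (shift i t x)) has_vector_derivative f' x) (at 0)"
      "Ck k S f'" using Ck_SucE[OF Suc.prems(1) i] by blast
    obtain g' where g': "\<And>x. x \<in> S \<Longrightarrow> ((\<lambda>t. g (shift i t x)) has_vector_derivative g' x) (at 0)"
      "Ck k S g'" using Ck_SucE[OF Suc.prems(2) i] by blast
    show "\<exists>h. (\<forall>x\<in>S. ((\<lambda>t. f (shift i t x) + g (shift i t x)) has_vector_derivative h x) (at 0)) \<and> Ck k S h"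
      using f' g' Suc.IH by (intro exI[of _ "\<lambda>x. f' x + g' x"]) (auto intro: has_vector_derivative_add)
  qed
qed (simp add: continuous_on_add)

lemma Ck_scaleR:
  fixes f :: "'p \<Rightarrow> real"
  shows "Ck k S f \<Longrightarrow> Ck k S g \<Longrightarrow> Ck k S (\<lambda>x. f x *\<^sub>R g x)"
proof (induction k arbitrary: f g)
  case (Suc k)
  show ?case
  proof (rule Ck_SucI)
    show "continuous_on S (\<lambda>x. f x *\<^sub>R g x)"
      using Suc.prems by (auto intro: continuous_on_scaleR)
    fix i assume i: "i \<in> I"
    obtain f' where f': "\<And>x. x \<in> S \<Longrightarrow> ((\<lambda>t. f (shift i t x)) has_vector_derivative f' x) (at 0)"
      "Ck k S f'" using Ck_SucE[OF Suc.prems(1) i] by blast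
    obtain g' where g': "\<And>x. x \<in> S \<Longrightarrow> ((\<lambda>t. g (shift i t x)) has_vector_derivative g' x) (at 0)"
      "Ck k S g'" using Ck_SucE[OF Suc.prems(2) i] by blast
    have "((\<lambda>t. f (shift i t x) *\<^sub>R g (shift i t x)) has_vector_derivative f x *\<^sub>R g' x + f' x *\<^sub>R g x) (at 0)"
      if "x \<in> S" for x
      using bounded_bilinear.has_vector_derivative[OF bounded_bilinear_scaleR f'(1)[OF that] g'(1)[OF that]]
      by (simp add: shift_0[OF i])
    moreover have "Ck k S (\<lambda>x. f x *\<^sub>R g' x + f' x *\<^sub>R g x)"
      by (rule Ck_add[OF Suc.IH[OF Ck_Suc_D[OF Suc.prems(1)] g'(2)]
            Suc.IH[OF f'(2) Ck_Suc_D[OF Suc.prems(2)]]])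
    ultimately show "\<exists>h. (\<forall>x\<in>S. ((\<lambda>t. f (shift i t x) *\<^sub>R g (shift i t x)) has_vector_derivative h x) (at 0)) \<and> Ck k S h"
      by (intro exI[of _ "\<lambda>x. f x *\<^sub>R g' x + f' x *\<^sub>R g x"] conjI ballI)
  qed
qed (simp add: continuous_on_scaleR)

lemma Ck_mult:
  fixes f g :: "'p \<Rightarrow> real"
  shows "Ck k S f \<Longrightarrow> Ck k S g \<Longrightarrow> Ck k S (\<lambda>x. f x * g x)"
  using Ck_scaleR[of k S f g] by simp

text \<open>The derivative of \<open>1 / f\<close> is a product of \<open>f'\<close> and two factors
  \<open>1 / f\<close>, which the induction on \<open>k\<close> provides one order lower.\<close>

lemma Ck_inverse:
  fixes f :: "'p \<Rightarrow> real"
  assumes "Ck k S f" and nz: "\<And>x. x \<in> S \<Longrightarrow> f x \<noteq> 0"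
  shows "Ck k S (\<lambda>x. inverse (f x))"
  using assms(1)
proof (induction k)
  case 0
  then show ?case using nz by (auto intro!: continuous_on_inverse)
next
  case (Suc k)
  have IH: "Ck k S (\<lambda>x. inverse (f x))"
    using Suc Ck_Suc_D by blast
  show ?case
  proof (rule Ck_SucI)
    show "continuous_on S (\<lambda>x. inverse (f x))"
      using Ck_continuous[OF IH] .
    fix i assume i: "i \<in> I"
    obtain f' where f': "\<And>x. x \<in> S \<Longrightarrow> ((\<lambda>t. f (shift i t x)) has_vector_derivative f' x) (at 0)"
      "Ck k S f'" using Ck_SucE[OF Suc.prems i] by blast
    have "((\<lambda>t. inverse (f (shift i t x))) has_vector_derivative
        -1 * (f' x * (inverse (f x) * inverse (f x)))) (at 0)" (is "(?F x has_vector_derivative ?h x) _") if "x \<in> S" for x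
      using DERIV_inverse'[OF f'(1)[OF that, folded has_real_derivative_iff_has_vector_derivative]] nz[OF that]
      by (simp add: shift_0[OF i] has_real_derivative_iff_has_vector_derivative mult_ac)
    moreover have "Ck k S (\<lambda>x. -1 * (f' x * (inverse (f x) * inverse (f x))))"
      by (intro Ck_mult Ck_const IH f')
    ultimately show "\<exists>h. (\<forall>x\<in>S. ((\<lambda>t. inverse (f (shift i t x))) has_vector_derivative h x) (at 0)) \<and> Ck k S h"
      by (intro exI[of _ ?h] conjI ballI)
  qed
qed

lemma Ck_sum:
  assumes "finite J" "\<And>j. j \<in> J \<Longrightarrow> Ck k S (f j)"
  shows "Ck k S (\<lambda>x. \<Sum>j\<in>J. f j x)"
  using assms by (induction J rule: finite_induct) (auto intro: Ck_const Ck_add)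

lemma Ck_prod:
  fixes f :: "'j \<Rightarrow> 'p \<Rightarrow> real"
  assumes "finite J" "\<And>j. j \<in> J \<Longrightarrow> Ck k S (f j)"
  shows "Ck k S (\<lambda>x. \<Prod>j\<in>J. f j x)"
  using assms by (induction J rule: finite_induct) (auto intro: Ck_const Ck_mult)

lemma Ck_det:
  fixes A :: "'p \<Rightarrow> real^'n^'n"
  assumes "\<And>i j. Ck k S (\<lambda>x. A x $ i $ j)"
  shows "Ck k S (\<lambda>x. det (A x))"
  unfolding det_def
  by (rule Ck_sum, simp, rule Ck_mult[OF Ck_const], rule Ck_prod) (simp_all add: assms)

lemma Ck_matrix:
  fixes A :: "'p \<Rightarrow> real^'n^'m"
  assumes "\<And>i j. Ck k S (\<lambda>x. A x $ i $ j)"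
  shows "Ck k S A"
proof -
  have "A = (\<lambda>x. \<Sum>i\<in>UNIV. \<Sum>j\<in>UNIV. A x $ i $ j *\<^sub>R axis i (axis j 1))"
  proof
    fix x
    have "(\<Sum>i\<in>UNIV. \<Sum>j\<in>UNIV. A x $ i $ j *\<^sub>R axis i (axis j 1)) $ p $ q = A x $ p $ q" for p q
    proof -
      have "(\<Sum>j\<in>UNIV. A x $ i $ j * axis i (axis j 1) $ p $ q) = (if p = i then A x $ p $ q else 0)" for i
      proof (cases "p = i")
        case True
        then have "A x $ i $ j * axis i (axis j 1) $ p $ q = (if q = j then A x $ p $ q else 0)" for j
          by (simp add: axis_def)
        then show ?thesis using True by simp
      qed (simp add: axis_def)
      then show ?thesis by simp
    qed
    then show "A x = (\<Sum>i\<in>UNIV. \<Sum>j\<in>UNIV. A x $ i $ j *\<^sub>R axis i (axis j 1))"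
      by (simp add: vec_eq_iff)
  qed
  then show ?thesis
    by (rule ssubst[where P = "Ck k S"]) (rule Ck_sum[OF finite], rule Ck_sum[OF finite], rule Ck_scaleR[OF assms Ck_const])
qed

text \<open>Entrywise smoothness passes through matrix products and Cramer's rule by arithmetic of
  real functions; \<open>Ck_matrix\<close> leads back to the matrix-valued map.\<close>

definition Ck_entries :: "nat \<Rightarrow> 'p set \<Rightarrow> ('p \<Rightarrow> real^'n^'m) \<Rightarrow> bool" where
  "Ck_entries k S A \<longleftrightarrow> (\<forall>i j. Ck k S (\<lambda>x. A x $ i $ j))"

lemma Ck_entries_const: "Ck_entries k S (\<lambda>x. c)"
  unfolding Ck_entries_def by (intro allI Ck_const)

lemma Ck_entries_constant_derivative:
  fixes A :: "'p \<Rightarrow> real^'n^'m"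
  assumes "continuous_on S A"
    and "\<And>i x. i \<in> I \<Longrightarrow> x \<in> S \<Longrightarrow> ((\<lambda>t. A (shift i t x)) has_vector_derivative c i) (at 0)"
  shows "Ck_entries k S A"
  unfolding Ck_entries_def
proof (intro allI)
  fix p q
  have bl: "bounded_linear (\<lambda>B :: real^'n^'m. B $ p $ q)"
    using bounded_linear_compose[OF bounded_linear_vec_nth bounded_linear_vec_nth] .
  show "Ck k S (\<lambda>x. A x $ p $ q)"
  proof (rule Ck_constant_derivative)
    show "continuous_on S (\<lambda>x. A x $ p $ q)"
      using bounded_linear.continuous_on[OF bl assms(1)] .
    show "((\<lambda>t. A (shift i t x) $ p $ q) has_vector_derivative c i $ p $ q) (at 0)"
      if "i \<in> I" "x \<in> S" for i x
      using bounded_linear.has_vector_derivative[OF bl assms(2)[OF that]] .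
  qed
qed

lemma Ck_entries_add: "Ck_entries k S A \<Longrightarrow> Ck_entries k S B \<Longrightarrow> Ck_entries k S (\<lambda>x. A x + B x)"
  unfolding Ck_entries_def vector_add_component by (intro allI, rule Ck_add) blast+

lemma Ck_entries_diff: "Ck_entries k S A \<Longrightarrow> Ck_entries k S B \<Longrightarrow> Ck_entries k S (\<lambda>x. A x - B x)"
  unfolding Ck_entries_def
proof (intro allI)
  fix i j
  assume A: "\<forall>i j. Ck k S (\<lambda>x. A x $ i $ j)" and B: "\<forall>i j. Ck k S (\<lambda>x. B x $ i $ j)"
  have "Ck k S (\<lambda>x. A x $ i $ j + (-1) * B x $ i $ j)"
    by (rule Ck_add[OF A[rule_format] Ck_mult[OF Ck_const B[rule_format]]])
  then show "Ck k S (\<lambda>x. (A x - B x) $ i $ j)" by simp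
qed

lemma Ck_entries_mult:
  "Ck_entries k S A \<Longrightarrow> Ck_entries k S B \<Longrightarrow> Ck_entries k S (\<lambda>x. A x ** B x)"
  unfolding Ck_entries_def matrix_matrix_mult_def vec_lambda_beta
  by (rule allI, rule allI, rule Ck_sum[OF finite], rule Ck_mult) blast+

lemma Ck_entries_cramer_inv:
  assumes "Ck_entries k S A" "\<And>x. x \<in> S \<Longrightarrow> det (A x) \<noteq> 0"
  shows "Ck_entries k S (\<lambda>x. cramer_inv (A x))"
proof -
  have A: "Ck k S (\<lambda>x. A x $ i $ j)" for i j
    using assms(1) by (simp add: Ck_entries_def)
  have "Ck k S (\<lambda>x. det (\<chi> p q. if q = i then mat 1 $ p $ j else A x $ p $ q) * inverse (det (A x)))" for i j
  proof (intro Ck_mult Ck_det Ck_inverse)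
    show "Ck k S (\<lambda>x. (\<chi> p q. if q = i then mat 1 $ p $ j else A x $ p $ q) $ p $ q)" for p q
      by (cases "q = i") (simp_all add: A[simplified] Ck_const)
  qed (use A assms(2) in blast)+
  then show ?thesis
    unfolding Ck_entries_def cramer_inv_def divide_inverse vec_lambda_beta by blast
qed

end

interpretation ambient: coordinate_shift "\<lambda>b t x :: 'a::euclidean_space. x + t *\<^sub>R b" Basis
  by unfold_locales simp

interpretation line: coordinate_shift "\<lambda>_ t x :: real. x + t" "{()}"
  by unfold_locales simp

lemma Ck_entries_matrix_id: "ambient.Ck_entries k S (\<lambda>Q :: real^'n^'m. Q)"
proof (rule ambient.Ck_entries_constant_derivative[where c = "\<lambda>b. b"])
  show "((\<lambda>t. Q + t *\<^sub>R b) has_vector_derivative b) (at 0)" for Q b :: "real^'n^'m"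
    using has_vector_derivative_add[OF has_vector_derivative_const
        has_vector_derivative_scaleR[OF DERIV_ident has_vector_derivative_const]] by force
qed (rule continuous_on_id)

lemma continuous_on_det_add: "continuous_on UNIV (\<lambda>Q :: real^'n^'n. det (P + Q))"
proof -
  have "ambient.Ck_entries 0 UNIV (\<lambda>Q :: real^'n^'n. P + Q)"
    by (rule ambient.Ck_entries_add[OF ambient.Ck_entries_const Ck_entries_matrix_id])
  then show ?thesis
    using ambient.Ck_det[of 0 UNIV "\<lambda>Q. P + Q"] by (simp add: ambient.Ck_entries_def)
qed

lemma open_det_add_nonzero: "open {Q :: real^'n^'n. det (P + Q) \<noteq> 0}"
  by (intro open_Collect_neq continuous_on_det_add continuous_on_const)

section \<open>The explicit solution\<close>

text \<open>Equal Gram matrices mean that \<open>M\<close> and \<open>N\<close> stretch every vector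
  alike, so the quotient is an isometry. The flow and the Cayley transform both have this
  shape.\<close>

lemma special_orthogonal_quotient:
  fixes M N :: "real^'n^'n"
  assumes N: "det N \<noteq> 0" and MN: "transpose M ** M = transpose N ** N" and "det M = det N"
  shows "M ** cramer_inv N \<in> special_orthogonal"
proof -
  have "transpose (M ** cramer_inv N) ** (M ** cramer_inv N)
      = transpose (cramer_inv N) ** (transpose M ** M) ** cramer_inv N"
    by (simp add: matrix_transpose_mul matrix_mul_assoc)
  also have "\<dots> = transpose (N ** cramer_inv N) ** (N ** cramer_inv N)"
    unfolding MN by (simp add: matrix_transpose_mul matrix_mul_assoc)
  also have "\<dots> = mat 1"
    by (simp add: cramer_inv_right[OF N])
  finally have "orthogonal_matrix (M ** cramer_inv N)"
    by (simp add: orthogonal_matrix)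
  moreover have "det N * det (cramer_inv N) = 1"
    using cramer_inv_right[OF N] by (metis det_I det_mul)
  ultimately show ?thesis
    using assms(3) by (simp add: special_orthogonal_def det_mul)
qed

text \<open>
  On the special orthogonal group the equation is the Riccati equation \<open>\<Theta>' = I - \<Theta>\<^sup>2\<close>.
  Linearising it gives the solution \<open>\<Theta> = S C\<inverse>\<close> with \<open>C = cosh t I + sinh t Q\<close> and \<open>S = C'\<close>,
  here divided through by \<open>cosh t\<close> and written in terms of \<open>r = tanh t\<close>.
\<close>

definition flow :: "real^'n^'n \<Rightarrow> real \<Rightarrow> real^'n^'n" where
  "flow Q r = (Q + r *\<^sub>R mat 1) ** cramer_inv (mat 1 + r *\<^sub>R Q)"

text \<open>A kernel vector satisfies \<open>x = - (r *\<^sub>R (Q *v x))\<close>, and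
  \<open>Q\<close> preserves its length, which is then scaled by a factor below 1.\<close>

lemma det_flow_denominator:
  fixes Q :: "real^'n^'n"
  assumes Q: "Q \<in> special_orthogonal" and r: "\<bar>r\<bar> < 1"
  shows "det (mat 1 + r *\<^sub>R Q) \<noteq> 0"
  unfolding det_nonzero_iff_kernel
proof (intro allI impI)
  fix x assume "(mat 1 + r *\<^sub>R Q) *v x = 0"
  then have x: "x = - (r *\<^sub>R (Q *v x))"
    by (simp add: matrix_vector_mult_add_rdistrib eq_neg_iff_add_eq_0 flip: scaleR_matrix_vector_assoc)
  have "norm (Q *v x) = norm x"
    using Q by (simp add: special_orthogonal_def orthogonal_matrix_inner norm_eq)
  then have "norm x = \<bar>r\<bar> * norm x"
    using x by (metis norm_minus_cancel norm_scaleR)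
  then show "x = 0" using r by simp
qed

text \<open>Clearing the denominator leaves an equation linear in \<open>A\<close>, convenient for
  differentiating the flow and for recognising other solutions as the flow.\<close>

lemma flow_eq_iff:
  assumes "det (mat 1 + r *\<^sub>R Q) \<noteq> 0"
  shows "A = flow Q r \<longleftrightarrow> A ** (mat 1 + r *\<^sub>R Q) = Q + r *\<^sub>R mat 1"
proof
  show "A ** (mat 1 + r *\<^sub>R Q) = Q + r *\<^sub>R mat 1" if "A = flow Q r"
    unfolding that flow_def by (simp add: cramer_inv_left[OF assms] flip: matrix_mul_assoc)
  then have "flow Q r ** (mat 1 + r *\<^sub>R Q) = Q + r *\<^sub>R mat 1"
    unfolding flow_def by (simp add: cramer_inv_left[OF assms] flip: matrix_mul_assoc)
  then show "A = flow Q r" if "A ** (mat 1 + r *\<^sub>R Q) = Q + r *\<^sub>R mat 1"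
    using that matrix_mult_right_cancel[OF assms] by metis
qed

lemma flow_in_special_orthogonal:
  fixes Q :: "real^'n^'n"
  assumes Q: "Q \<in> special_orthogonal" and r: "\<bar>r\<bar> < 1"
  shows "flow Q r \<in> special_orthogonal"
  unfolding flow_def
proof (rule special_orthogonal_quotient[OF det_flow_denominator[OF assms]])
  have o: "transpose Q ** Q = mat 1" "Q ** transpose Q = mat 1"
    using Q by (auto simp: special_orthogonal_def orthogonal_matrix_def)
  show "transpose (Q + r *\<^sub>R mat 1) ** (Q + r *\<^sub>R mat 1)
      = transpose (mat 1 + r *\<^sub>R Q) ** (mat 1 + r *\<^sub>R Q)"
    by (simp add: transpose_add transpose_scalar matrix_mult_simps o algebra_simps)
  have "Q + r *\<^sub>R mat 1 = Q ** transpose (mat 1 + r *\<^sub>R Q)"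
    by (simp add: transpose_add transpose_scalar matrix_mult_simps o)
  then show "det (Q + r *\<^sub>R mat 1) = det (mat 1 + r *\<^sub>R Q)"
    using Q by (simp add: det_mul special_orthogonal_def)
qed

text \<open>The entries are rational in \<open>r\<close>. Existence suffices, since the cleared
  equation will determine the derivative. The point \<open>r = 1\<close> is included when -1 is not
  an eigenvalue of \<open>Q\<close>; this later yields the limit.\<close>

lemma flow_has_derivative:
  fixes Q :: "real^'n^'n"
  assumes r: "det (mat 1 + r *\<^sub>R Q) \<noteq> 0"
  shows "\<exists>D. (flow Q has_vector_derivative D) (at r)"
proof -
  define S where "S = {s. det (mat 1 + s *\<^sub>R Q) \<noteq> 0}"
  have "line.Ck_entries 1 S (flow Q)"
    unfolding flow_def
    by (intro line.Ck_entries_mult line.Ck_entries_cramer_inv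
        line.Ck_entries_constant_derivative[where c = "\<lambda>_. mat 1"]
        line.Ck_entries_constant_derivative[where c = "\<lambda>_. Q"])
       (auto simp: S_def intro!: derivative_eq_intros continuous_intros)
  then have "line.Ck (Suc 0) S (flow Q)"
    by (intro line.Ck_matrix) (simp add: line.Ck_entries_def)
  then obtain g where "\<And>s. s \<in> S \<Longrightarrow> ((\<lambda>t. flow Q (s + t)) has_vector_derivative g s) (at 0)"
    using line.Ck_SucE[of 0 S "flow Q" "()"] by auto
  moreover have "r \<in> S" using r by (simp add: S_def)
  ultimately have "((\<lambda>t. flow Q (r + t)) has_vector_derivative g r) (at 0)"
    by blast
  then have "(((\<lambda>t. flow Q (r + t)) \<circ> (\<lambda>s. s - r)) has_vector_derivative 1 *\<^sub>R g r) (at r)"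
    by (intro vector_diff_chain_at) (auto intro!: derivative_eq_intros)
  then show ?thesis by (auto simp: o_def)
qed

definition vector_field :: "real^'n^'n \<Rightarrow> real^'n^'n" where
  "vector_field \<Theta> = (transpose \<Theta> - \<Theta>) ** \<Theta>"

lemma vector_field_special_orthogonal:
  "\<Theta> \<in> special_orthogonal \<Longrightarrow> vector_field \<Theta> = mat 1 - \<Theta> ** \<Theta>"
  by (simp add: vector_field_def matrix_mult_simps special_orthogonal_def orthogonal_matrix_def)

lemma abs_tanh_less_1: "\<bar>tanh t\<bar> < 1" for t :: real
  using tanh_real_bounds[of t] by auto

lemma ode_solution_flow:
  fixes Q :: "real^'n^'n"
  assumes Q: "Q \<in> special_orthogonal"
  shows "ode_solution vector_field special_orthogonal Q (\<lambda>t. flow Q (tanh t))"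
  unfolding ode_solution_def
proof (intro conjI allI impI)
  have eq: "flow Q (tanh t) ** (mat 1 + tanh t *\<^sub>R Q) = Q + tanh t *\<^sub>R mat 1" for t
    using flow_eq_iff[OF det_flow_denominator[OF Q abs_tanh_less_1]] by blast
  show "flow Q (tanh 0) = Q"
    using eq[of 0] by simp
  fix t :: real
  show so: "flow Q (tanh t) \<in> special_orthogonal"
    by (rule flow_in_special_orthogonal[OF Q abs_tanh_less_1])
  obtain D where D: "(flow Q has_vector_derivative D) (at (tanh t))"
    using flow_has_derivative[OF det_flow_denominator[OF Q abs_tanh_less_1]] by blast
  define r where "r = tanh t"
  have tanh': "(tanh has_vector_derivative 1 - r\<^sup>2) (at t)"
    unfolding r_def has_real_derivative_iff_has_vector_derivative[symmetric]
    by (auto intro!: derivative_eq_intros)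
  define E where "E = (1 - r\<^sup>2) *\<^sub>R D"
  have flow': "((\<lambda>t. flow Q (tanh t)) has_vector_derivative E) (at t)"
    using vector_diff_chain_at[OF tanh' D] by (simp add: o_def E_def)
  have N': "((\<lambda>t. mat 1 + tanh t *\<^sub>R Q) has_vector_derivative (1 - r\<^sup>2) *\<^sub>R Q) (at t)"
    unfolding r_def by (auto intro!: derivative_eq_intros)
  have M': "((\<lambda>t. Q + tanh t *\<^sub>R mat 1) has_vector_derivative (1 - r\<^sup>2) *\<^sub>R mat 1) (at t)"
    unfolding r_def by (auto intro!: derivative_eq_intros)
  let ?A = "flow Q r"
  have A: "?A + r *\<^sub>R (?A ** Q) = Q + r *\<^sub>R mat 1"
    using eq[of t] by (simp add: r_def matrix_mult_simps)
  \<comment> \<open>The product rule, applied to the cleared equation \<open>eq\<close>, determines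
    \<open>E\<close>.\<close>
  have "?A ** ((1 - r\<^sup>2) *\<^sub>R Q) + E ** (mat 1 + r *\<^sub>R Q) = (1 - r\<^sup>2) *\<^sub>R mat 1"
    using vector_derivative_unique_at[OF mm.has_vector_derivative[OF flow' N', unfolded eq] M']
    by (simp add: r_def)
  then have "E ** (mat 1 + r *\<^sub>R Q) = (1 - r\<^sup>2) *\<^sub>R (mat 1 - ?A ** Q)"
    by (simp add: matrix_mult_simps algebra_simps)
  \<comment> \<open>Equation \<open>A\<close> is used twice: on the right factor of
    \<open>?A ** ?A\<close>, and then to rewrite the remaining
    \<open>r *\<^sub>R ?A\<close>.\<close>
  also have "\<dots> = (mat 1 - ?A ** ?A) ** (mat 1 + r *\<^sub>R Q)"
  proof -
    have AQ: "?A = Q + r *\<^sub>R mat 1 - r *\<^sub>R (?A ** Q)"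
      using A by (simp add: algebra_simps)
    have "(mat 1 - ?A ** ?A) ** (mat 1 + r *\<^sub>R Q) = mat 1 + r *\<^sub>R Q - ?A ** (?A + r *\<^sub>R (?A ** Q))"
      by (simp add: matrix_mult_simps matrix_mul_assoc scaleR_diff_right)
    also have "\<dots> = mat 1 + r *\<^sub>R Q - ?A ** Q - r *\<^sub>R ?A"
      unfolding A by (simp add: matrix_mult_simps)
    also have "\<dots> = mat 1 + r *\<^sub>R Q - ?A ** Q - r *\<^sub>R (Q + r *\<^sub>R mat 1 - r *\<^sub>R (?A ** Q))"
      using AQ by simp
    also have "\<dots> = (1 - r\<^sup>2) *\<^sub>R (mat 1 - ?A ** Q)"
      by (simp add: algebra_simps power2_eq_square)
    finally show ?thesis by simp
  qed
  finally have "E = vector_field ?A"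
    using matrix_mult_right_cancel[OF det_flow_denominator[OF Q abs_tanh_less_1]]
      vector_field_special_orthogonal[OF so] unfolding r_def by metis
  then show "((\<lambda>t. flow Q (tanh t)) has_vector_derivative vector_field (flow Q (tanh t))) (at t within {0..})"
    using flow' by (simp add: r_def has_vector_derivative_at_within)
qed

section \<open>Uniqueness, convergence and stability\<close>

lemma nonincreasing_on_half_line:
  fixes h :: "real \<Rightarrow> real"
  assumes h: "\<And>t. 0 \<le> t \<Longrightarrow> (h has_vector_derivative h' t) (at t within {0..})"
    and "\<And>t. 0 \<le> t \<Longrightarrow> h' t \<le> 0" and "0 \<le> t"
  shows "h t \<le> h 0"
proof -
  have "\<exists>s\<in>{0..t}. h t - h 0 = (\<lambda>x. x *\<^sub>R h' s) (t - 0)"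
  proof (rule mvt_very_simple[OF assms(3)])
    fix s assume "0 \<le> s" "s \<le> t"
    then show "(h has_derivative (\<lambda>x. x *\<^sub>R h' s)) (at s within {0..t})"
      using has_vector_derivative_within_subset[OF h[of s], of "{0..t}"]
      by (auto simp: has_vector_derivative_def)
  qed
  then obtain s where "0 \<le> s" "h t - h 0 = t * h' s" by auto
  moreover have "t * h' s \<le> 0"
    using assms(2)[OF \<open>0 \<le> s\<close>] assms(3) by (simp add: mult_nonneg_nonpos)
  ultimately show ?thesis by simp
qed

text \<open>\<open>region_of_attraction\<close> speaks of all solutions, so convergence of the
  explicit one does not suffice.\<close>

lemma ode_solution_eq_flow:
  fixes \<theta> :: "real \<Rightarrow> real^'n^'n"
  assumes sol: "ode_solution vector_field special_orthogonal Q \<theta>" and t: "0 \<le> t"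
  shows "\<theta> t = flow Q (tanh t)"
proof -
  have Q: "\<theta> 0 = Q" and so: "\<And>t. 0 \<le> t \<Longrightarrow> \<theta> t \<in> special_orthogonal"
    and \<theta>': "\<And>t. 0 \<le> t \<Longrightarrow> (\<theta> has_vector_derivative mat 1 - \<theta> t ** \<theta> t) (at t within {0..})"
    using sol by (auto simp: ode_solution_def vector_field_special_orthogonal)
  have Q_so: "Q \<in> special_orthogonal" using so[of 0] Q by simp
  define C S where "C s = cosh s *\<^sub>R mat 1 + sinh s *\<^sub>R Q"
    and "S s = sinh s *\<^sub>R mat 1 + cosh s *\<^sub>R Q" for s :: real
  \<comment> \<open>\<open>Y' = - \<theta> Y\<close> with \<open>\<theta>\<close> an isometry, so \<open>exp (-2 s) |Y s|\<^sup>2\<close> is nonincreasing and \<open>Y\<close> vanishes.\<close>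
  define Y where "Y s = \<theta> s ** C s - S s" for s
  have C': "(C has_vector_derivative S s) (at s within {0..})" for s
    unfolding C_def S_def by (auto intro!: derivative_eq_intros)
  have S': "(S has_vector_derivative C s) (at s within {0..})" for s
    unfolding C_def S_def by (auto intro!: derivative_eq_intros)
  \<comment> \<open>The product rule gives \<open>(mat 1 - \<theta> s ** \<theta> s) ** C s +
    \<theta> s ** S s - C s\<close>, where \<open>C s\<close> cancels.\<close>
  have Y': "(Y has_vector_derivative - (\<theta> s ** Y s)) (at s within {0..})" if "0 \<le> s" for s
    using has_vector_derivative_diff[OF mm.has_vector_derivative[OF \<theta>'[OF that] C'] S'[of s]]
    unfolding Y_def by (simp add: matrix_mult_simps matrix_mul_assoc algebra_simps)
  define h where "h s = exp (-2 * s) * (Y s \<bullet> Y s)" for s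
  have "h t \<le> h 0"
  proof (rule nonincreasing_on_half_line[OF _ _ t])
    fix s :: real assume s: "0 \<le> s"
    show "(h has_vector_derivative -2 * exp (-2 * s) * (Y s \<bullet> Y s + Y s \<bullet> (\<theta> s ** Y s))) (at s within {0..})"
    proof -
      have "((\<lambda>s. exp (-2 * s)) has_vector_derivative -2 * exp (-2 * s)) (at s within {0..})"
        unfolding has_real_derivative_iff_has_vector_derivative[symmetric]
        by (auto intro!: derivative_eq_intros)
      moreover have "((\<lambda>s. Y s \<bullet> Y s) has_vector_derivative
          Y s \<bullet> - (\<theta> s ** Y s) + - (\<theta> s ** Y s) \<bullet> Y s) (at s within {0..})"
        using bounded_bilinear.has_vector_derivative[OF bounded_bilinear_inner Y'[OF s] Y'[OF s]] .
      ultimately show ?thesis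
        unfolding h_def by (rule has_vector_derivative_eq_rhs[OF has_vector_derivative_mult])
          (simp add: inner_commute algebra_simps)
    qed
    have "norm (\<theta> s ** Y s) = norm (Y s)"
      using so[OF s] by (simp add: special_orthogonal_def norm_matrix_mult_orthogonal)
    then have "\<bar>Y s \<bullet> (\<theta> s ** Y s)\<bar> \<le> Y s \<bullet> Y s"
      using Cauchy_Schwarz_ineq2[of "Y s" "\<theta> s ** Y s"] by (simp add: dot_square_norm power2_eq_square)
    then show "-2 * exp (-2 * s) * (Y s \<bullet> Y s + Y s \<bullet> (\<theta> s ** Y s)) \<le> 0"
      by (simp add: mult_nonpos_nonneg)
  qed
  moreover have "h 0 = 0"
    by (simp add: h_def Y_def C_def S_def Q)
  ultimately have "exp (-2 * t) * (Y t \<bullet> Y t) \<le> 0"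
    unfolding h_def by linarith
  then have "Y t \<bullet> Y t \<le> 0"
    by (meson exp_gt_zero mult_le_0_iff not_le)
  then have "Y t = 0"
    by (meson inner_gt_zero_iff not_le)
  then have eq: "cosh t *\<^sub>R \<theta> t + sinh t *\<^sub>R (\<theta> t ** Q) = sinh t *\<^sub>R mat 1 + cosh t *\<^sub>R Q"
    by (simp add: Y_def C_def S_def matrix_mult_simps)
  have "\<theta> t ** (mat 1 + tanh t *\<^sub>R Q) = (1 / cosh t) *\<^sub>R (cosh t *\<^sub>R \<theta> t + sinh t *\<^sub>R (\<theta> t ** Q))"
    by (simp add: matrix_mult_simps tanh_def scaleR_add_right)
  also have "\<dots> = Q + tanh t *\<^sub>R mat 1"
    unfolding eq by (simp add: tanh_def scaleR_add_right)
  finally show ?thesis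
    using flow_eq_iff[OF det_flow_denominator[OF Q_so abs_tanh_less_1]] by blast
qed

text \<open>At \<open>r = 1\<close> numerator and denominator of the flow coincide, and the
  hypothesis makes the flow continuous there.\<close>

lemma flow_tendsto_identity:
  fixes Q :: "real^'n^'n"
  assumes "det (mat 1 + Q) \<noteq> 0"
  shows "((\<lambda>t. flow Q (tanh t)) \<longlongrightarrow> mat 1) at_top"
proof -
  have "isCont (flow Q) 1"
    using flow_has_derivative[of 1 Q] assms has_vector_derivative_continuous by fastforce
  moreover have "flow Q 1 = mat 1"
    using flow_eq_iff[of 1 Q "mat 1"] assms by (simp add: add.commute)
  ultimately show ?thesis
    using isCont_tendsto_compose[OF _ tanh_real_at_top] by fastforce
qed

lemma region_of_attraction_identity:
  "{Q \<in> special_orthogonal. det (mat 1 + Q) \<noteq> 0}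
    \<subseteq> region_of_attraction vector_field special_orthogonal (mat 1 :: real^'n^'n)"
proof
  fix Q :: "real^'n^'n" assume Q: "Q \<in> {Q \<in> special_orthogonal. det (mat 1 + Q) \<noteq> 0}"
  have "(\<theta> \<longlongrightarrow> mat 1) at_top" if "ode_solution vector_field special_orthogonal Q \<theta>" for \<theta>
  proof -
    have "\<forall>\<^sub>F t in at_top. flow Q (tanh t) = \<theta> t"
      using eventually_ge_at_top[of 0] by eventually_elim (simp add: ode_solution_eq_flow[OF that])
    then show ?thesis
      using flow_tendsto_identity Q by (auto intro: Lim_transform_eventually)
  qed
  then show "Q \<in> region_of_attraction vector_field special_orthogonal (mat 1)"
    using Q ode_solution_flow by (auto simp: region_of_attraction_def)
qed

lemma dist_identity_nonincreasing:
  fixes \<theta> :: "real \<Rightarrow> real^'n^'n"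
  assumes sol: "ode_solution vector_field special_orthogonal Q \<theta>" and t: "0 \<le> t"
  shows "dist (\<theta> t) (mat 1) \<le> dist Q (mat 1)"
proof -
  let ?I = "mat 1 :: real^'n^'n"
  have Q: "\<theta> 0 = Q" and so: "\<And>t. 0 \<le> t \<Longrightarrow> \<theta> t \<in> special_orthogonal"
    and \<theta>': "\<And>t. 0 \<le> t \<Longrightarrow> (\<theta> has_vector_derivative ?I - \<theta> t ** \<theta> t) (at t within {0..})"
    using sol by (auto simp: ode_solution_def vector_field_special_orthogonal)
  have nrm: "norm A = norm ?I" if "A \<in> special_orthogonal" for A :: "real^'n^'n"
    using norm_matrix_mult_orthogonal[of A ?I] that by (simp add: special_orthogonal_def)
  \<comment> \<open>All rotations have the norm of the identity, so the distance to it is governed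
    by one inner product.\<close>
  have d: "(dist A ?I)\<^sup>2 = 2 * (norm ?I)\<^sup>2 - 2 * (A \<bullet> ?I)" if "A \<in> special_orthogonal" for A :: "real^'n^'n"
    using nrm[OF that] by (simp add: dist_norm power2_norm_eq_inner inner_simps inner_commute norm_eq)
  have "(dist (\<theta> t) ?I)\<^sup>2 \<le> (dist Q ?I)\<^sup>2"
  proof -
    have "- (\<theta> t \<bullet> ?I) \<le> - (\<theta> 0 \<bullet> ?I)"
    proof (rule nonincreasing_on_half_line[OF _ _ t])
      fix s :: real assume s: "0 \<le> s"
      show "((\<lambda>s. - (\<theta> s \<bullet> ?I)) has_vector_derivative - ((?I - \<theta> s ** \<theta> s) \<bullet> ?I)) (at s within {0..})"
        by (intro has_vector_derivative_minus
            bounded_linear.has_vector_derivative[OF bounded_linear_inner_left] \<theta>' s)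
      \<comment> \<open>\<open>\<theta> s ** \<theta> s\<close> is again a rotation, so both norms
        equal that of \<open>?I\<close>.\<close>
      have "(\<theta> s ** \<theta> s) \<bullet> ?I \<le> norm (\<theta> s ** \<theta> s) * norm ?I"
        by (rule norm_cauchy_schwarz)
      also have "\<dots> = ?I \<bullet> ?I"
        using nrm[OF special_orthogonal_mult[OF so[OF s] so[OF s]]]
        by (simp add: dot_square_norm power2_eq_square)
      finally show "- ((?I - \<theta> s ** \<theta> s) \<bullet> ?I) \<le> 0"
        by (simp add: inner_diff_left)
    qed
    then show ?thesis
      using d[OF so[OF t]] d[OF so[of 0]] Q by simp
  qed
  then show ?thesis
    by (rule power2_le_imp_le) simp
qed

lemma asymptotically_stable_identity:
  "asymptotically_stable vector_field special_orthogonal (mat 1 :: real^'n^'n)"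
  unfolding asymptotically_stable_def
proof
  \<comment> \<open>The choice \<open>\<delta> = \<epsilon>\<close> works, because the distance
    never increases.\<close>
  show "lyapunov_stable vector_field special_orthogonal (mat 1 :: real^'n^'n)"
    unfolding lyapunov_stable_def
    using ode_solution_flow dist_identity_nonincreasing by (meson order_le_less_trans)
  have "mat 1 \<in> {Q :: real^'n^'n. det (mat 1 + Q) \<noteq> 0}"
    by (simp add: det_nonzero_iff_kernel matrix_vector_mult_add_rdistrib flip: scaleR_2)
  then obtain \<delta> where \<delta>: "\<delta> > 0" "ball (mat 1) \<delta> \<subseteq> {Q :: real^'n^'n. det (mat 1 + Q) \<noteq> 0}"
    using open_det_add_nonzero open_contains_ball by blast
  have "x0 \<in> region_of_attraction vector_field special_orthogonal (mat 1)"
    if "x0 \<in> special_orthogonal" "dist x0 (mat 1) < \<delta>" for x0 :: "real^'n^'n"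
  proof -
    have "x0 \<in> ball (mat 1) \<delta>"
      using that(2) by (simp add: dist_commute)
    then show ?thesis
      using \<delta>(2) region_of_attraction_identity that(1) by blast
  qed
  then show "\<exists>\<delta>>0. \<forall>x0\<in>special_orthogonal. dist x0 (mat 1) < \<delta> \<longrightarrow>
      x0 \<in> region_of_attraction vector_field special_orthogonal (mat 1 :: real^'n^'n)"
    using \<delta>(1) by blast
qed

section \<open>The Cayley transform\<close>

definition cayley :: "real^'n^'n \<Rightarrow> real^'n^'n" where
  "cayley R = (mat 1 - R) ** cramer_inv (mat 1 + R)"

lemma cayley_mult:
  assumes "det (mat 1 + R) \<noteq> 0"
  shows "cayley R ** (mat 1 + R) = mat 1 - R"
  unfolding cayley_def by (simp add: cramer_inv_left[OF assms] flip: matrix_mul_assoc)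

lemma mat_add_cayley_mult:
  fixes R :: "real^'n^'n"
  assumes "det (mat 1 + R) \<noteq> 0"
  shows "(mat 1 + cayley R) ** (mat 1 + R) = 2 *\<^sub>R mat 1"
  by (simp only: mm.add_left cayley_mult[OF assms]) (simp add: algebra_simps scaleR_2)

lemma det_add_cayley:
  fixes R :: "real^'n^'n"
  assumes "det (mat 1 + R) \<noteq> 0"
  shows "det (mat 1 + cayley R) \<noteq> 0"
proof -
  have "det (2 *\<^sub>R mat 1 :: real^'n^'n) \<noteq> 0"
    by (simp add: det_nonzero_iff_kernel flip: scaleR_matrix_vector_assoc)
  then show ?thesis
    using mat_add_cayley_mult[OF assms] by (metis det_mul mult_zero_left)
qed

text \<open>Multiplied by \<open>mat 1 + R\<close>, the numerator and denominator of the second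
  transform become \<open>2 *\<^sub>R R\<close> and \<open>2 *\<^sub>R mat 1\<close>.\<close>

lemma cayley_cayley:
  fixes R :: "real^'n^'n"
  assumes R: "det (mat 1 + R) \<noteq> 0"
  shows "cayley (cayley R) = R"
proof (rule matrix_mult_right_cancel[OF det_add_cayley[OF R]], rule matrix_mult_right_cancel[OF R])
  have "cayley (cayley R) ** (mat 1 + cayley R) ** (mat 1 + R) = (mat 1 - cayley R) ** (mat 1 + R)"
    by (simp only: cayley_mult[OF det_add_cayley[OF R]])
  also have "\<dots> = 2 *\<^sub>R R"
    by (simp only: mm.diff_left cayley_mult[OF R]) (simp add: scaleR_2)
  also have "\<dots> = R ** (mat 1 + cayley R) ** (mat 1 + R)"
    by (simp only: mat_add_cayley_mult[OF R] mm.scaleR_right matrix_mul_rid flip: matrix_mul_assoc)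
  finally show "cayley (cayley R) ** (mat 1 + cayley R) ** (mat 1 + R) = R ** (mat 1 + cayley R) ** (mat 1 + R)" .
qed

text \<open>The quadratic form of a skew matrix vanishes, but on a kernel vector it would equal
  minus the squared length. This lets every point of coordinate space parametrise a
  rotation.\<close>

lemma det_add_skew:
  fixes X :: "real^'n^'n"
  assumes X: "transpose X = - X"
  shows "det (mat 1 + X) \<noteq> 0"
  unfolding det_nonzero_iff_kernel
proof (intro allI impI)
  fix x assume "(mat 1 + X) *v x = 0"
  then have x: "X *v x = - x"
    by (simp add: matrix_vector_mult_add_rdistrib eq_neg_iff_add_eq_0 add.commute)
  have "x \<bullet> (X *v x) = (transpose X *v x) \<bullet> x"
    by (simp add: dot_lmul_matrix)
  also have "\<dots> = - ((X *v x) \<bullet> x)"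
    by (simp add: X scaleR_matrix_vector_assoc[of "-1", simplified, symmetric])
  finally show "x = 0"
    by (simp add: x)
qed

lemma cayley_skew:
  fixes X :: "real^'n^'n"
  assumes X: "transpose X = - X"
  shows "cayley X \<in> special_orthogonal"
  unfolding cayley_def
proof (rule special_orthogonal_quotient[OF det_add_skew[OF X]])
  show "transpose (mat 1 - X) ** (mat 1 - X) = transpose (mat 1 + X) ** (mat 1 + X)"
    by (simp add: transpose_add transpose_diff X matrix_mult_simps)
  have "transpose (mat 1 + X) = mat 1 - X"
    by (simp add: transpose_add X)
  then show "det (mat 1 - X) = det (mat 1 + X)"
    by (metis det_transpose)
qed

text \<open>The factors \<open>mat 1 - R\<close> and \<open>mat 1 + R\<close> commute, so
  \<open>cayley R\<close> solves the equation with \<open>mat 1 + R\<close> on the left too.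
  Transposing the original equation and multiplying by \<open>R\<close> gives the same one with the
  opposite sign.\<close>

lemma transpose_cayley_orthogonal:
  fixes R :: "real^'n^'n"
  assumes o: "orthogonal_matrix R" and R: "det (mat 1 + R) \<noteq> 0"
  shows "transpose (cayley R) = - cayley R"
proof -
  let ?N = "mat 1 + R" and ?S = "cayley R"
  have "?N ** ?S ** ?N = (mat 1 - R) ** ?N"
    by (simp add: cayley_mult[OF R] flip: matrix_mul_assoc) (simp add: matrix_mult_simps algebra_simps)
  then have NS: "?N ** ?S = mat 1 - R"
    by (rule matrix_mult_right_cancel[OF R])
  have "transpose ?N ** transpose ?S = transpose (mat 1 - R)"
    by (simp only: cayley_mult[OF R] flip: matrix_transpose_mul)
  then have "R ** (transpose ?N ** transpose ?S) = R ** transpose (mat 1 - R)"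
    by simp
  moreover have "R ** transpose ?N = ?N" "R ** transpose (mat 1 - R) = - (mat 1 - R)"
    using o by (simp_all add: orthogonal_matrix_def transpose_add transpose_diff matrix_mult_simps)
  ultimately have "?N ** transpose ?S = ?N ** (- ?S)"
    by (simp add: matrix_mul_assoc mm.minus_right NS)
  then have "cramer_inv ?N ** ?N ** transpose ?S = cramer_inv ?N ** ?N ** (- ?S)"
    by (simp flip: matrix_mul_assoc)
  then show ?thesis
    by (simp add: cramer_inv_left[OF R])
qed

section \<open>Coordinates on skew-symmetric matrices\<close>

text \<open>The positions above the diagonal; the index type carries no order, so
  \<open>to_nat\<close> supplies one.\<close>

definition upper_pairs :: "('n::finite \<times> 'n) set" where
  "upper_pairs = {(i, j). to_nat i < to_nat j}"

text \<open>The off-diagonal positions split into the upper pairs and their converses.\<close>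

lemma card_upper_pairs: "card (upper_pairs :: ('n::finite \<times> 'n) set) = CARD('n) * (CARD('n) - 1) div 2"
proof -
  let ?D = "upper_pairs :: ('n \<times> 'n) set"
  have un: "?D \<union> ?D\<inverse> = UNIV - Id"
    by (auto simp: upper_pairs_def) (metis inj_to_nat injD linorder_neqE_nat)
  have "card (?D \<union> ?D\<inverse>) = card ?D + card (?D\<inverse>)"
    by (rule card_Un_disjoint) (auto simp: upper_pairs_def)
  also have "card (?D\<inverse>) = card ?D"
    by (simp add: card_inverse)
  finally have "2 * card ?D = card (UNIV - Id :: ('n \<times> 'n) set)"
    by (simp add: un)
  also have "\<dots> = CARD('n \<times> 'n) - card (Id :: ('n \<times> 'n) set)"
    by (rule card_Diff_subset) auto
  also have "card (Id :: ('n \<times> 'n) set) = CARD('n)"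
    by (simp add: Id_def card_image inj_on_def Collect_mem_eq image_def[symmetric] Setcompr_eq_image full_SetCompr_eq)
  also have "CARD('n \<times> 'n) - CARD('n) = CARD('n) * (CARD('n) - 1)"
    by (simp add: diff_mult_distrib2)
  finally show ?thesis by simp
qed

definition skew_dim :: "'n::finite itself \<Rightarrow> nat" where
  "skew_dim _ = card (upper_pairs :: ('n \<times> 'n) set)"

definition pair_index :: "'n::finite \<times> 'n \<Rightarrow> nat" where
  "pair_index = (SOME g. bij_betw g upper_pairs {..<skew_dim TYPE('n)})"

lemma bij_betw_pair_index:
  "bij_betw pair_index (upper_pairs :: ('n::finite \<times> 'n) set) {..<skew_dim TYPE('n)}"
proof -
  have "\<exists>g. bij_betw g (upper_pairs :: ('n \<times> 'n) set) {..<skew_dim TYPE('n)}"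
    using ex_bij_betw_finite_nat[of "upper_pairs :: ('n \<times> 'n) set"]
    by (auto simp: skew_dim_def atLeast0LessThan)
  then show ?thesis
    unfolding pair_index_def by (rule someI_ex)
qed

definition skew_matrix :: "(nat \<Rightarrow> real) \<Rightarrow> real^'n^'n" where
  "skew_matrix x = (\<chi> i j. if (i, j) \<in> upper_pairs then x (pair_index (i, j))
     else if (j, i) \<in> upper_pairs then - x (pair_index (j, i)) else 0)"

text \<open>The restriction makes the result extensional, as \<open>coord_space\<close>
  demands.\<close>

definition skew_coords :: "real^'n^'n \<Rightarrow> nat \<Rightarrow> real" where
  "skew_coords A = (\<lambda>k\<in>{..<skew_dim TYPE('n)}. case inv_into upper_pairs pair_index k of (i, j) \<Rightarrow> A $ i $ j)"

lemma transpose_skew_matrix: "transpose (skew_matrix x) = - skew_matrix x"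
  by (auto simp: skew_matrix_def transpose_def vec_eq_iff upper_pairs_def)

lemma skew_coords_in_coord_space: "skew_coords (A :: real^'n^'n) \<in> coord_space (skew_dim TYPE('n))"
  by (auto simp: skew_coords_def coord_space_def)

lemma skew_coords_skew_matrix:
  assumes x: "x \<in> coord_space (skew_dim TYPE('n::finite))"
  shows "skew_coords (skew_matrix x :: real^'n^'n) = x"
proof
  fix k
  show "skew_coords (skew_matrix x :: real^'n^'n) k = x k"
  proof (cases "k < skew_dim TYPE('n)")
    case True
    obtain i j :: 'n where ij: "inv_into upper_pairs pair_index k = (i, j)"
      by fastforce
    have "k \<in> pair_index ` (upper_pairs :: ('n \<times> 'n) set)"
      using bij_betw_pair_index[where 'n = 'n] True by (auto simp: bij_betw_def)
    then have "(i, j) \<in> upper_pairs" "pair_index (i, j) = k"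
      using inv_into_into[of k pair_index "upper_pairs :: ('n \<times> 'n) set"]
        f_inv_into_f[of k pair_index "upper_pairs :: ('n \<times> 'n) set"] ij by auto
    then show ?thesis
      using True by (simp add: skew_coords_def ij skew_matrix_def)
  next
    case False
    then show ?thesis
      using x by (auto simp: skew_coords_def coord_space_def PiE_def extensional_def)
  qed
qed

lemma skew_matrix_skew_coords:
  fixes A :: "real^'n^'n"
  assumes A: "transpose A = - A"
  shows "skew_matrix (skew_coords A) = A"
proof -
  have anti: "A $ j $ i = - A $ i $ j" for i j
    using arg_cong[OF A, of "\<lambda>B. B $ i $ j"] by (simp add: transpose_def)
  have entry: "skew_coords A (pair_index (i, j)) = A $ i $ j" if "(i, j) \<in> upper_pairs" for i j :: 'n
  proof -
    have "pair_index (i, j) < skew_dim TYPE('n)"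
      "inv_into upper_pairs pair_index (pair_index (i, j)) = (i, j)"
      using bij_betw_pair_index[where 'n = 'n] that by (auto simp: bij_betw_def)
    then show ?thesis by (simp add: skew_coords_def)
  qed
  have "skew_matrix (skew_coords A) $ i $ j = A $ i $ j" for i j
  proof -
    consider "(i, j) \<in> upper_pairs" | "(i, j) \<notin> upper_pairs" "(j, i) \<in> upper_pairs" | "i = j"
      by (auto simp: upper_pairs_def) (metis inj_to_nat injD linorder_neqE_nat)
    then show ?thesis
    proof cases
      case 2
      then show ?thesis
        using anti[of i j] by (simp add: skew_matrix_def entry)
    next
      case 3
      then show ?thesis
        using anti[of i i] by (simp add: skew_matrix_def upper_pairs_def)
    qed (simp add: skew_matrix_def entry)
  qed
  then show ?thesis by (simp add: vec_eq_iff)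
qed

lemma skew_matrix_update:
  "skew_matrix (x(k := t)) = skew_matrix (x(k := 0)) + t *\<^sub>R skew_matrix ((\<lambda>_. 0)(k := 1))"
  by (auto simp: skew_matrix_def vec_eq_iff)

lemma skew_matrix_shift:
  "skew_matrix (x(k := x k + t)) = skew_matrix x + t *\<^sub>R skew_matrix ((\<lambda>_. 0)(k := 1))"
  by (auto simp: skew_matrix_def vec_eq_iff)

interpretation coords: coordinate_shift "\<lambda>i t x :: nat \<Rightarrow> real. x(i := x i + t)" "{..<m}" for m
  by unfold_locales simp

lemma Ck_entries_skew_matrix: "coords.Ck_entries m k S (skew_matrix :: _ \<Rightarrow> real^'n^'n)"
proof (rule coords.Ck_entries_constant_derivative[where c = "\<lambda>i. skew_matrix ((\<lambda>_. 0)(i := 1))"])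
  have c: "continuous_on S (\<lambda>x :: nat \<Rightarrow> real. x k)" for k
    by (rule continuous_on_product_then_coordinatewise[OF continuous_on_id, unfolded id_def])
  have "continuous_on S (\<lambda>x. if (i, j) \<in> upper_pairs then x (pair_index (i, j))
     else if (j, i) \<in> upper_pairs then - x (pair_index (j, i)) else (0::real))" for i j :: 'n
    by (cases "(i, j) \<in> upper_pairs"; cases "(j, i) \<in> upper_pairs")
      (simp_all add: c continuous_on_minus)
  then show "continuous_on S (skew_matrix :: _ \<Rightarrow> real^'n^'n)"
    unfolding skew_matrix_def by (intro continuous_on_vec_lambda)
  show "((\<lambda>t. skew_matrix (x(i := x i + t))) has_vector_derivative skew_matrix ((\<lambda>_. 0)(i := 1))) (at 0)" for i x
    unfolding skew_matrix_shift by (auto intro!: derivative_eq_intros)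
qed

section \<open>Cayley charts around arbitrary rotations\<close>

text \<open>The left translate by \<open>P\<close> of the rotations without eigenvalue -1: the
  condition says that -1 is not an eigenvalue of \<open>transpose P ** Q\<close>.\<close>

definition chart_domain :: "real^'n^'n \<Rightarrow> (real^'n^'n) set" where
  "chart_domain P = {Q \<in> special_orthogonal. det (P + Q) \<noteq> 0}"

definition cayley_chart :: "real^'n^'n \<Rightarrow> real^'n^'n \<Rightarrow> nat \<Rightarrow> real" where
  "cayley_chart P Q = skew_coords (cayley (transpose P ** Q))"

definition cayley_param :: "real^'n^'n \<Rightarrow> (nat \<Rightarrow> real) \<Rightarrow> real^'n^'n" where
  "cayley_param P x = P ** cayley (skew_matrix x)"

context
  fixes P :: "real^'n^'n"
  assumes P: "P \<in> special_orthogonal"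
begin

lemma transpose_base_point: "transpose P ** P = mat 1" "P ** transpose P = mat 1"
  using P by (auto simp: special_orthogonal_def orthogonal_matrix_def)

lemma det_left_translate: "det (mat 1 + transpose P ** Q) = det (P + Q)"
proof -
  have "mat 1 + transpose P ** Q = transpose P ** (P + Q)"
    by (simp add: matrix_mult_simps transpose_base_point)
  then show ?thesis
    using P by (simp add: det_mul special_orthogonal_def)
qed

lemma det_add_self: "det (P + P) \<noteq> 0"
  unfolding det_left_translate[symmetric] transpose_base_point
  by (simp add: det_nonzero_iff_kernel matrix_vector_mult_add_rdistrib flip: scaleR_2 scaleR_matrix_vector_assoc)

lemma cayley_param_in_domain: "cayley_param P x \<in> chart_domain P"
proof -
  let ?C = "cayley (skew_matrix x) :: real^'n^'n"
  have "det (mat 1 + transpose P ** (P ** ?C)) \<noteq> 0"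
    using det_add_cayley[OF det_add_skew[OF transpose_skew_matrix]]
    by (simp add: matrix_mul_assoc transpose_base_point)
  then show ?thesis
    using special_orthogonal_mult[OF P cayley_skew[OF transpose_skew_matrix]]
    by (simp add: chart_domain_def cayley_param_def det_left_translate)
qed

lemma cayley_chart_param:
  assumes "x \<in> coord_space (skew_dim TYPE('n))"
  shows "cayley_chart P (cayley_param P x) = x"
  unfolding cayley_chart_def cayley_param_def
  by (simp add: matrix_mul_assoc transpose_base_point cayley_cayley[OF det_add_skew[OF transpose_skew_matrix]]
      skew_coords_skew_matrix[OF assms])

lemma cayley_param_chart:
  assumes "Q \<in> chart_domain P"
  shows "cayley_param P (cayley_chart P Q) = Q"
proof -
  let ?R = "transpose P ** Q"
  have R: "orthogonal_matrix ?R" "det (mat 1 + ?R) \<noteq> 0"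
    using assms P by (auto simp: chart_domain_def special_orthogonal_def det_left_translate
        orthogonal_matrix_mul)
  show ?thesis
    unfolding cayley_chart_def cayley_param_def
      skew_matrix_skew_coords[OF transpose_cayley_orthogonal[OF R]] cayley_cayley[OF R(2)]
    by (simp add: matrix_mul_assoc transpose_base_point)
qed

lemma cayley_chart_image: "cayley_chart P ` chart_domain P = coord_space (skew_dim TYPE('n))"
proof
  show "cayley_chart P ` chart_domain P \<subseteq> coord_space (skew_dim TYPE('n))"
    by (auto simp: cayley_chart_def skew_coords_in_coord_space)
  show "coord_space (skew_dim TYPE('n)) \<subseteq> cayley_chart P ` chart_domain P"
    using cayley_chart_param cayley_param_in_domain by (metis image_eqI subsetI)
qed

text \<open>The chart formula is smooth on an open set of arbitrary matrices, not only of rotations;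
  this is the extension that \<open>smooth_on_subset\<close> asks for.\<close>

lemma Ck_cayley_chart:
  assumes "i < skew_dim TYPE('n)"
  shows "ambient.Ck k {Q. det (P + Q) \<noteq> 0} (\<lambda>Q. cayley_chart P Q i)"
proof -
  note R = ambient.Ck_entries_mult[OF ambient.Ck_entries_const Ck_entries_matrix_id, of _ _ "transpose P"]
  have "ambient.Ck_entries k {Q. det (P + Q) \<noteq> 0} (\<lambda>Q. cayley (transpose P ** Q))"
    unfolding cayley_def
    by (rule ambient.Ck_entries_mult[OF ambient.Ck_entries_diff[OF ambient.Ck_entries_const R]
          ambient.Ck_entries_cramer_inv[OF ambient.Ck_entries_add[OF ambient.Ck_entries_const R]]])
       (simp add: det_left_translate)
  then show ?thesis
    using assms
    by (cases "inv_into (upper_pairs :: ('n \<times> 'n) set) pair_index i")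
       (simp add: ambient.Ck_entries_def cayley_chart_def skew_coords_def)
qed

lemma Ck_cayley_param: "coords.Ck m k S (cayley_param P)"
proof (rule coords.Ck_matrix)
  note X = Ck_entries_skew_matrix[where 'n = 'n, of m k S]
  have "coords.Ck_entries m k S (cayley_param P)"
    unfolding cayley_param_def cayley_def
    by (rule coords.Ck_entries_mult[OF coords.Ck_entries_const
        coords.Ck_entries_mult[OF coords.Ck_entries_diff[OF coords.Ck_entries_const X]
          coords.Ck_entries_cramer_inv[OF coords.Ck_entries_add[OF coords.Ck_entries_const X]]]])
       (rule det_add_skew[OF transpose_skew_matrix])
  then show "coords.Ck m k S (\<lambda>x. cayley_param P x $ i $ j)" for i j
    by (simp add: coords.Ck_entries_def)
qed

lemma smooth_chart_cayley:
  "smooth_chart (skew_dim TYPE('n)) special_orthogonal (chart_domain P) (cayley_chart P)"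
  unfolding smooth_chart_def cayley_chart_image
proof (intro conjI allI impI exI[of _ "cayley_param P"])
  let ?V = "{Q. det (P + Q) \<noteq> 0}"
  have dom: "chart_domain P = special_orthogonal \<inter> ?V"
    by (auto simp: chart_domain_def)
  show "openin (top_of_set special_orthogonal) (chart_domain P)"
    unfolding dom by (rule openin_open_Int[OF open_det_add_nonzero])
  show "openin (top_of_set (coord_space (skew_dim TYPE('n)))) (coord_space (skew_dim TYPE('n)))"
    by simp
  show "smooth_on_subset (chart_domain P) (\<lambda>Q. cayley_chart P Q i)" if "i < skew_dim TYPE('n)" for i
    unfolding smooth_on_subset_def smooth_on_open_def
    using Ck_cayley_chart[OF that] open_det_add_nonzero[of P] dom
    by (intro ballI exI[of _ ?V] exI[of _ "\<lambda>Q. cayley_chart P Q i"]) auto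
  show "homeomorphism (chart_domain P) (coord_space (skew_dim TYPE('n))) (cayley_chart P) (cayley_param P)"
    unfolding homeomorphism_def
  proof (intro conjI ballI)
    show "continuous_on (chart_domain P) (cayley_chart P)"
    proof (rule continuous_on_coordinatewise_then_product)
      fix i
      show "continuous_on (chart_domain P) (\<lambda>Q. cayley_chart P Q i)"
      proof (cases "i < skew_dim TYPE('n)")
        case True
        show ?thesis
          by (rule continuous_on_subset[OF ambient.Ck_continuous[OF Ck_cayley_chart[OF True]]])
             (auto simp: dom)
      qed (simp add: cayley_chart_def skew_coords_def)
    qed
    show "continuous_on (coord_space (skew_dim TYPE('n))) (cayley_param P)"
      by (rule coords.Ck_continuous[OF Ck_cayley_param])
    show "cayley_param P ` coord_space (skew_dim TYPE('n)) = chart_domain P"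
      using cayley_param_in_domain cayley_param_chart cayley_chart_image
      by (metis (no_types, lifting) image_cong image_ident image_image)
  qed (simp_all add: cayley_chart_image cayley_param_chart cayley_chart_param)
  show "smooth_on_coord_space (skew_dim TYPE('n)) (coord_space (skew_dim TYPE('n))) (cayley_param P)"
    unfolding smooth_on_coord_space_def using Ck_cayley_param by blast
qed

section \<open>The exceptional set in a chart\<close>

definition pencil :: "(nat \<Rightarrow> real) \<Rightarrow> real^'n^'n" where
  "pencil x = (mat 1 + skew_matrix x) + P ** (mat 1 - skew_matrix x)"

text \<open>
  Clearing the denominator of the Cayley transform in \<open>I + cayley_param P x\<close> leaves a determinant that
  is a polynomial in each coordinate separately.
\<close>

lemma det_pencil:
  "det (pencil x) = det (mat 1 + cayley_param P x) * det (mat 1 + skew_matrix x :: real^'n^'n)"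
proof -
  have "pencil x = (mat 1 + cayley_param P x) ** (mat 1 + skew_matrix x)"
    by (simp add: pencil_def cayley_param_def mm.add_left
        cayley_mult[OF det_add_skew[OF transpose_skew_matrix]] flip: matrix_mul_assoc)
  then show ?thesis by (simp add: det_mul)
qed

text \<open>The origin can fail as a witness, its value being \<open>det (mat 1 + P)\<close>.
  Density gives a rotation in the chart domain without eigenvalue -1, and its coordinates
  serve.\<close>

lemma pencil_det_not_identically_zero:
  "\<exists>x \<in> coord_space (skew_dim TYPE('n)). det (pencil x) \<noteq> 0"
proof -
  obtain Q where Q: "Q \<in> {Q. det (P + Q) \<noteq> 0}" "Q \<in> special_orthogonal" "det (mat 1 + Q) \<noteq> 0"
    using special_orthogonal_open_meets_det_nonzero[OF open_det_add_nonzero, of P P] P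
      det_add_self by blast
  then have "Q \<in> chart_domain P" by (simp add: chart_domain_def)
  then have "det (pencil (cayley_chart P Q)) \<noteq> 0"
    using Q(3) det_add_skew[OF transpose_skew_matrix] by (simp add: det_pencil cayley_param_chart)
  then show ?thesis
    by (auto simp: cayley_chart_def skew_coords_in_coord_space)
qed

lemma real_polynomial_function_pencil:
  "real_polynomial_function (\<lambda>t. det (pencil (x(k := t))))"
proof (rule real_polynomial_function_det)
  fix i j
  define B :: "real^'n^'n" where "B = skew_matrix ((\<lambda>_. 0)(k := 1))"
  \<comment> \<open>Changing one coordinate moves the pencil along a line, so each entry has degree
    at most 1 in \<open>t\<close>.\<close>
  have affine: "pencil (x(k := t)) = pencil (x(k := 0)) + t *\<^sub>R (B - P ** B)" for t
    unfolding pencil_def skew_matrix_update[of x k t] B_def by (simp add: matrix_mult_simps algebra_simps)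
  have eq: "(\<lambda>t. pencil (x(k := t)) $ i $ j) = (\<lambda>t. pencil (x(k := 0)) $ i $ j + t * (B - P ** B) $ i $ j)"
  proof
    fix t
    show "pencil (x(k := t)) $ i $ j = pencil (x(k := 0)) $ i $ j + t * (B - P ** B) $ i $ j"
      by (subst affine) simp
  qed
  show "real_polynomial_function (\<lambda>t. pencil (x(k := t)) $ i $ j)"
    unfolding eq
    by (rule real_polynomial_function.intros(3)[OF real_polynomial_function.intros(2)
        real_polynomial_function.intros(4)[OF real_polynomial_function.intros(1)[OF bounded_linear_ident]
          real_polynomial_function.intros(2)]])
qed

lemma borel_measurable_det_pencil:
  "(\<lambda>x. det (pencil x)) \<in> borel_measurable (Pi\<^sub>M {..<skew_dim TYPE('n)} (\<lambda>_. lborel))"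
proof -
  have [measurable]: "(\<lambda>x. skew_matrix x $ i $ j) \<in> borel_measurable (Pi\<^sub>M {..<skew_dim TYPE('n)} (\<lambda>_. lborel))"
    for i j :: 'n
  proof -
    have "pair_index (i, j) < skew_dim TYPE('n)" if "(i, j) \<in> upper_pairs" for i j :: 'n
      using bij_betw_pair_index[where 'n = 'n] that by (auto simp: bij_betw_def)
    then have "(\<lambda>x. x (pair_index (i, j))) \<in> borel_measurable (Pi\<^sub>M {..<skew_dim TYPE('n)} (\<lambda>_. lborel))"
      if "(i, j) \<in> upper_pairs" for i j :: 'n
      using measurable_component_singleton[of "pair_index (i, j)" "{..<skew_dim TYPE('n)}" "\<lambda>_. lborel :: real measure"]
        that by simp
    then show ?thesis
      by (cases "(i, j) \<in> upper_pairs"; cases "(j, i) \<in> upper_pairs") (simp_all add: skew_matrix_def)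
  qed
  show ?thesis
    unfolding det_def pencil_def matrix_matrix_mult_def by simp measurable
qed

lemma cayley_chart_null:
  "cayley_chart P ` ({Q \<in> special_orthogonal. det (mat 1 + Q) = 0} \<inter> chart_domain P)
    \<in> null_sets (completion (Pi\<^sub>M {..<skew_dim TYPE('n)} (\<lambda>_. lborel)))" (is "?A \<in> _")
proof -
  let ?M = "Pi\<^sub>M {..<skew_dim TYPE('n)} (\<lambda>_. lborel :: real measure)"
  note [measurable] = borel_measurable_det_pencil
  obtain c where "c \<in> {..<skew_dim TYPE('n)} \<rightarrow>\<^sub>E UNIV" "det (pencil c) \<noteq> 0"
    using pencil_det_not_identically_zero by (auto simp: coord_space_def)
  then have "AE x in ?M. det (pencil x) \<noteq> 0"
    by (intro AE_PiM_separately_polynomial_nonzero[OF _ borel_measurable_det_pencil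
          real_polynomial_function_pencil]) auto
  then have "{x \<in> space ?M. det (pencil x) = 0} \<in> null_sets ?M"
    by (subst (asm) AE_iff_null) auto
  moreover have "?A \<subseteq> {x \<in> space ?M. det (pencil x) = 0}"
  proof
    fix x assume "x \<in> ?A"
    then obtain Q where "x = cayley_chart P Q" "Q \<in> chart_domain P" "det (mat 1 + Q) = 0"
      by auto
    then show "x \<in> {x \<in> space ?M. det (pencil x) = 0}"
      using cayley_chart_image by (auto simp: det_pencil cayley_param_chart space_PiM coord_space_def)
  qed
  \<comment> \<open>The image is only known to lie inside a null set; the completion makes it null
    as well.\<close>
  ultimately show ?thesis
    by (meson null_sets_completionI null_sets_completion_subset)
qed

end

section \<open>Measure zero on the manifold\<close>

lemma manifold_measure_zero_det_zero:
  "manifold_measure_zero (skew_dim TYPE('n)) special_orthogonal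
    {Q :: real^'n^'n \<in> special_orthogonal. det (mat 1 + Q) = 0}"
proof -
  let ?A = "{Q :: real^'n^'n \<in> special_orthogonal. det (mat 1 + Q) = 0}"
  \<comment> \<open>One chart for every rotation; it contains its base point because
    \<open>P + P\<close> is invertible, so the domains cover.\<close>
  let ?C = "(\<lambda>P :: real^'n^'n. (chart_domain P, cayley_chart P)) ` special_orthogonal"
  have "P \<in> chart_domain P" if "P \<in> special_orthogonal" for P :: "real^'n^'n"
    unfolding chart_domain_def using det_add_self that by blast
  then show ?thesis
    unfolding manifold_measure_zero_def
    by (intro conjI exI[of _ ?C]) (auto simp: smooth_chart_cayley cayley_chart_null)
qed

lemma manifold_measure_zero_subset:
  assumes A: "manifold_measure_zero m M A" and "B \<subseteq> A"
  shows "manifold_measure_zero m M B"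
proof -
  obtain \<C> where \<C>: "\<forall>(U, \<phi>)\<in>\<C>. smooth_chart m M U \<phi>" "A \<subseteq> (\<Union>(U, \<phi>)\<in>\<C>. U)"
    "\<forall>(U, \<phi>)\<in>\<C>. \<phi> ` (A \<inter> U) \<in> null_sets (completion (Pi\<^sub>M {..<m} (\<lambda>_. lborel)))"
    using A by (auto simp: manifold_measure_zero_def)
  have "\<phi> ` (B \<inter> U) \<in> null_sets (completion (Pi\<^sub>M {..<m} (\<lambda>_. lborel)))" if "(U, \<phi>) \<in> \<C>" for U \<phi>
    using \<C>(3) that \<open>B \<subseteq> A\<close> null_sets_completion_subset[of "\<phi> ` (B \<inter> U)" "\<phi> ` (A \<inter> U)"] by blast
  then show ?thesis
    unfolding manifold_measure_zero_def
    using A \<C>(1,2) \<open>B \<subseteq> A\<close> by (intro conjI exI[of _ \<C>]) (auto simp: manifold_measure_zero_def)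
qed

theorem corollary8:
  "almost_globally_asymptotically_stable (CARD('n) * (CARD('n) - 1) div 2)
     (\<lambda>\<Theta> :: real ^ 'n ^ 'n. (transpose \<Theta> - \<Theta>) ** \<Theta>) special_orthogonal (mat 1)"
proof -
  have f: "(\<lambda>\<Theta> :: real^'n^'n. (transpose \<Theta> - \<Theta>) ** \<Theta>) = vector_field"
    by (simp add: fun_eq_iff vector_field_def)
  have m: "CARD('n) * (CARD('n) - 1) div 2 = skew_dim TYPE('n)"
    by (simp add: skew_dim_def card_upper_pairs)
  have "equilibrium vector_field special_orthogonal (mat 1 :: real^'n^'n)"
    by (simp add: equilibrium_def vector_field_def special_orthogonal_def orthogonal_matrix_id)
  moreover have "special_orthogonal - region_of_attraction vector_field special_orthogonal (mat 1 :: real^'n^'n)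
      \<subseteq> {Q \<in> special_orthogonal. det (mat 1 + Q) = 0}"
    using region_of_attraction_identity by blast
  ultimately show ?thesis
    unfolding f m almost_globally_asymptotically_stable_def
    using asymptotically_stable_identity
      manifold_measure_zero_subset[OF manifold_measure_zero_det_zero] by blast
qed

end
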